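(* Let $\mu$ be a singular (with respect to Lebesgue measure) Borel probability measure on $\mathbb{R}$ belonging to the set $\mathcal{D}_{*}[\mathcal{N}]$, and let $\{B_n\}_{n=1}^{\infty}$ be a positive sequence for which the classical central limit theorem holds for $\mu$, i.e. $D_{1/B_n}\mu^{*n}\Rightarrow\mathcal{N}$ as $n\to\infty$. If $$\sum_{n=1}^{\infty}\frac{1}{B_n^2}=\infty,$$ then the boundary restriction of $F_\mu$ to $\mathbb{R}$ is conservative (and hence ergodic) as a measure preserving transformation of $(\mathbb{R},\mathcal{B},\lambda)$.
   Context: Let $\mathbb{C}^{+}=\{z\in\mathbb{C}:\Im z>0\}$, let $\lambda$ be Lebesgue measure on $\mathbb{R}$ and $\mathcal{B}$ the Borel $\sigma$-field of $\mathbb{R}$. For a Borel probability measure $\mu$ on $\mathbb{R}$, $F_\mu(z)=\left(\int_{-\infty}^{\infty}\frac{1}{z-t}\,d\mu(t)\right)^{-1}$, an analytic self-map of $\mathbb{C}^{+}$. $\mu^{*n}$ is the $n$-fold classical convolution power, $D_b\mu(A)=\mu(b^{-1}A)$ for $b>0$ and Borel $A$, $\Rightarrow$ denotes weak convergence, and $\mathcal{N}$ is the standard normal law. The strict domain of attraction $\mathcal{D}_{*}[\mathcal{N}]$ is the set of all Borel probability measures $\mu$ on $\mathbb{R}$ for which there exists a sequence $C_n>0$ with $D_{1/C_n}\mu^{*n}\Rightarrow\mathcal{N}$. When $\mu$ is singular with respect to $\lambda$, $F_\mu$ is an inner function on $\mathbb{C}^{+}$, that is, the limits $T(x)=\lim_{y\to0^{+}}F_\mu(x+iy)$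 exist and are real for $\lambda$-almost every $x\in\mathbb{R}$. The measurable map $T:\mathbb{R}\to\mathbb{R}$ (defined modulo null sets) is called the boundary restriction of $F_\mu$; it is known (Letac) that $T$ preserves $\lambda$, i.e. $\lambda(T^{-1}A)=\lambda(A)$ for all $A\in\mathcal{B}$. A measure preserving transformation $T$ of a $\sigma$-finite measure space $(X,\mathcal{F},\nu)$ is conservative if every $W\in\mathcal{F}$ for which the sets $\{T^{-n}W\}_{n=0}^{\infty}$ are pairwise disjoint satisfies $\nu(W)=0$; it is ergodic if every $A\in\mathcal{F}$ with $T^{-1}A=A$ satisfies $\nu(A)=0$ or $\nu(X\setminus A)=0$. *)

theory Defs
  imports "HOL-Probability.Probability"
begin

text \<open>Borel probability measures on the real line are the measures satisfying
  \<^term>\<open>real_distribution\<close>; Lebesgue measure on the Borel sets is \<^term>\<open>lborel\<close>.\<close>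

definition singular_to_lborel :: "real measure \<Rightarrow> bool" where
  "singular_to_lborel \<mu> \<longleftrightarrow>
     (\<exists>N \<in> sets borel. emeasure lborel N = 0 \<and> emeasure \<mu> (- N) = 0)"

primrec conv_power :: "real measure \<Rightarrow> nat \<Rightarrow> real measure" where
  "conv_power \<mu> 0 = return borel 0"
| "conv_power \<mu> (Suc n) = convolution \<mu> (conv_power \<mu> n)"

text \<open>For \<open>b > 0\<close> the preimage of \<open>A\<close> under \<open>x \<mapsto> b x\<close> is \<open>b\<inverse> A\<close>, so this is
  \<open>A \<mapsto> \<mu> (b\<inverse> A)\<close>.\<close>
definition dilation :: "real \<Rightarrow> real measure \<Rightarrow> real measure" where
  "dilation b \<mu> = distr \<mu> borel (\<lambda>x. b * x)"

text \<open>Sequences are indexed by the positive integers: the value at \<open>0\<close> is unconstrained and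
  has no influence on the limit.\<close>
definition clt_norming :: "real measure \<Rightarrow> (nat \<Rightarrow> real) \<Rightarrow> bool" where
  "clt_norming \<mu> C \<longleftrightarrow>
     (\<forall>n\<ge>1. C n > 0) \<and>
     weak_conv_m (\<lambda>n. dilation (1 / C n) (conv_power \<mu> n)) std_normal_distribution"

definition strict_normal_domain :: "real measure set" where
  "strict_normal_domain = {\<mu>. real_distribution \<mu> \<and> (\<exists>C. clt_norming \<mu> C)}"

definition F_transform :: "real measure \<Rightarrow> complex \<Rightarrow> complex" where
  "F_transform \<mu> z = inverse (\<integral>t. 1 / (z - complex_of_real t) \<partial>\<mu>)"

text \<open>The boundary restriction is determined only up to a Lebesgue null set, so it is given as a
  predicate which holds of each of its Borel measurable representatives.\<close>
definition boundary_restriction :: "real measure \<Rightarrow> (real \<Rightarrow> real) \<Rightarrow> bool" where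
  "boundary_restriction \<mu> T \<longleftrightarrow>
     T \<in> borel_measurable borel \<and>
     (AE x in lborel.
        ((\<lambda>y. F_transform \<mu> (Complex x y)) \<longlongrightarrow> complex_of_real (T x)) (at_right 0))"

definition measure_preserving_map :: "'a measure \<Rightarrow> ('a \<Rightarrow> 'a) \<Rightarrow> bool" where
  "measure_preserving_map M T \<longleftrightarrow>
     T \<in> measurable M M \<and>
     (\<forall>A \<in> sets M. emeasure M (T -` A \<inter> space M) = emeasure M A)"

definition conservative :: "'a measure \<Rightarrow> ('a \<Rightarrow> 'a) \<Rightarrow> bool" where
  "conservative M T \<longleftrightarrow>
     (\<forall>W \<in> sets M. disjoint_family (\<lambda>n. (T ^^ n) -` W \<inter> space M) \<longrightarrow> emeasure M W = 0)"

definition ergodic :: "'a measure \<Rightarrow> ('a \<Rightarrow> 'a) \<Rightarrow> bool" where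
  "ergodic M T \<longleftrightarrow>
     (\<forall>A \<in> sets M. T -` A \<inter> space M = A \<longrightarrow>
        emeasure M A = 0 \<or> emeasure M (space M - A) = 0)"

end

theory Submission
  imports Defs "HOL-Complex_Analysis.Complex_Analysis" "HOL-Real_Asymp.Real_Asymp"
begin

text \<open>
  Let \<open>P\<^sub>z\<close> be the Cauchy law with parameter \<open>z\<close> in the upper half-plane. By the Poisson formula applied
  to \<open>exp (i s F)\<close> the boundary map sends \<open>P\<^sub>z\<close> to the Cauchy law with parameter \<open>F z\<close>. Letting \<open>z\<close> tend to infinity
  along the imaginary axis gives invariance of Lebesgue measure. Put \<open>z\<^sub>n = F\<^sup>n(i)\<close>. If
  \<open>\<Sum> Im z\<^sub>n / |z\<^sub>n|\<^sup>2\<close> diverges, then the \<open>P\<^sub>i\<close>-measures of the preimages of a set of positive measure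
  have infinite sum, so the set is not wandering; and since the orbit violates the Blaschke
  condition, a bounded analytic function that is constant on it is constant, whence ergodicity.

  For the divergence, tightness of the normalised convolution powers gives
  \<open>|1 - \<phi>(u)| \<le> c / n\<close> for \<open>0 \<le> u \<le> \<delta> / B\<^sub>n\<close>, where \<open>\<phi>\<close> is the characteristic function. A Laplace
  transform turns this, with \<open>L = B\<^sub>n / \<delta>\<close>, into \<open>|F z - z| \<le> L / n\<close> whenever \<open>Im z \<ge> L\<close> and \<open>|z| \<le> 2 L\<close>.
  Hence \<open>|F\<^sup>n(i L)| \<le> 2 L\<close>, and Schwarz--Pick for \<open>- 1 / F\<^sup>n\<close> yields
  \<open>Im z\<^sub>n / |z\<^sub>n|\<^sup>2 \<ge> 1 / (4 L\<^sup>2)\<close>, a multiple of \<open>1 / B\<^sub>n\<^sup>2\<close>.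
\<close>

section \<open>Schwarz lemma and Blaschke condition in the half-plane\<close>

text \<open>The variance of \<mu> may be infinite, so there is no second-order expansion of
  \<open>F\<close> at infinity to iterate. What is known at index n is the size of 1 - \<phi> on an
  interval of length comparable to \<open>1 / B n\<close>, and this controls \<open>F\<close> only
  at heights of order \<open>B n\<close>. Schwarz-Pick is applied to -1 / F^n rather than to F^n
  because Im (-1 / w) = Im w / |w|^2 is the very quantity to be summed. On a bounded set, and for Im
  w \<ge> 1, this quantity is up to a constant a lower bound for the Poisson kernel at w; it also
  bounds from below, up to a constant, the defect from 1 of the squared modulus of a Blaschke factor
  with zero w. Hence one divergent series serves both conservativity and ergodicity.\<close>

abbreviation upper_half_plane :: "complex set" ("\<H>") where
  "\<H> \<equiv> {z. Im z > 0}"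

lemma open_uhp: "open \<H>"
  by (simp add: open_halfspace_Im_gt)

lemma convex_uhp: "convex \<H>"
  by (simp add: convex_halfspace_Im_gt)

text \<open>The conformal map of the half-plane onto the unit disc that sends a to 0; its modulus is
  the pseudohyperbolic distance of a and z.\<close>

definition blaschke_factor :: "complex \<Rightarrow> complex \<Rightarrow> complex" where
  "blaschke_factor a z = (z - a) / (z - cnj a)"

lemma uhp_diff_cnj_nz: "\<lbrakk>Im a > 0; Im z > 0\<rbrakk> \<Longrightarrow> z - cnj a \<noteq> 0"
  by (auto simp: complex_eq_iff)

text \<open>The defect from 1 is what the Blaschke condition sums: for fixed z and |a| \<ge> 1 it is
  at least a constant times Im a / |a|^2.\<close>

lemma norm_blaschke_factor_sq:
  assumes "Im a > 0" "Im z > 0"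
  shows "(norm (blaschke_factor a z))\<^sup>2 = 1 - 4 * Im a * Im z / (norm (z - cnj a))\<^sup>2"
proof -
  have "(norm (z - cnj a))\<^sup>2 > 0" using uhp_diff_cnj_nz[OF assms] by simp
  moreover have "(norm (z - a))\<^sup>2 = (norm (z - cnj a))\<^sup>2 - 4 * Im a * Im z"
    unfolding cmod_power2 by (simp add: power2_eq_square algebra_simps)
  ultimately show ?thesis
    unfolding blaschke_factor_def norm_divide power_divide by (simp add: field_simps)
qed

lemma norm_blaschke_factor_less_1:
  assumes "Im a > 0" "Im z > 0"
  shows "norm (blaschke_factor a z) < 1"
proof -
  have "(norm (z - cnj a))\<^sup>2 > 0" using uhp_diff_cnj_nz[OF assms] by simp
  then have "(norm (blaschke_factor a z))\<^sup>2 < 1\<^sup>2"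
    unfolding norm_blaschke_factor_sq[OF assms] using assms by simp
  then show ?thesis by (rule power_less_imp_less_base) simp
qed

text \<open>The Schwarz lemma of the disc, transported by \<open>m\<close>, the inverse of
  \<open>blaschke_factor a\<close>, which sends 0 to the zero a of g.\<close>

lemma holomorphic_uhp_le_blaschke:
  assumes hol: "g holomorphic_on \<H>" and bd: "\<And>z. z \<in> \<H> \<Longrightarrow> norm (g z) \<le> M"
    and a: "a \<in> \<H>" "g a = 0" and z: "z \<in> \<H>"
  shows "norm (g z) \<le> M * norm (blaschke_factor a z)"
proof -
  have M0: "M \<ge> 0" using bd[OF z] norm_ge_zero order_trans by blast
  define m where "m \<zeta> = (a - cnj a * \<zeta>) / (1 - \<zeta>)" for \<zeta>
  have mH: "m \<zeta> \<in> \<H>" if "norm \<zeta> < 1" for \<zeta>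
  proof -
    have "\<zeta> \<noteq> 1" using that by auto
    then have n0: "(norm (1 - \<zeta>))\<^sup>2 > 0" by simp
    have "Im (m \<zeta>) = Im ((a - cnj a * \<zeta>) * cnj (1 - \<zeta>)) / (norm (1 - \<zeta>))\<^sup>2"
      unfolding m_def by (subst complex_div_cnj) (simp add: Im_divide_of_real flip: of_real_power)
    also have "Im ((a - cnj a * \<zeta>) * cnj (1 - \<zeta>)) = Im a * (1 - (norm \<zeta>)\<^sup>2)"
      unfolding cmod_power2 by (simp add: algebra_simps power2_eq_square)
    finally have e: "Im (m \<zeta>) = Im a * (1 - (norm \<zeta>)\<^sup>2) / (norm (1 - \<zeta>))\<^sup>2" .
    have "(norm \<zeta>)\<^sup>2 < 1" using that by (simp add: abs_square_less_1)
    then show ?thesis using a n0 e by simp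
  qed
  have hm: "m holomorphic_on ball 0 1"
    unfolding m_def by (intro holomorphic_intros) auto
  define \<zeta> where "\<zeta> = blaschke_factor a z"
  have z1: "norm \<zeta> < 1" unfolding \<zeta>_def using norm_blaschke_factor_less_1 a z by auto
  have nz: "z - cnj a \<noteq> 0" using uhp_diff_cnj_nz a z by auto
  have "a - cnj a \<noteq> 0" using a by (auto simp: complex_eq_iff)
  moreover have "1 - \<zeta> = (a - cnj a) / (z - cnj a)" "a - cnj a * \<zeta> = (a - cnj a) * z / (z - cnj a)"
    unfolding \<zeta>_def blaschke_factor_def using nz by (simp_all add: field_simps)
  ultimately have mz: "m \<zeta> = z" unfolding m_def using nz by simp
  \<comment> \<open>The Schwarz lemma is applied under a strict bound by 1, so g is divided by a
    number strictly above M; this also covers M = 0. The excess is removed at the end by letting it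
    tend to 0.\<close>
  have *: "norm (g z) \<le> M' * norm \<zeta>" if "M' > M" for M'
  proof -
    have M': "M' > 0" using that M0 by simp
    let ?f = "\<lambda>\<zeta>. g (m \<zeta>) / M'"
    have "norm (?f \<zeta>) \<le> norm \<zeta>"
    proof (rule Schwarz_Lemma(1)[OF _ _ _ z1])
      have "(g \<circ> m) holomorphic_on ball 0 1"
        by (rule holomorphic_on_compose_gen[OF hm hol]) (use mH in auto)
      then show "?f holomorphic_on ball 0 1"
        unfolding comp_def using M' by (intro holomorphic_intros) auto
      show "?f 0 = 0" using a by (simp add: m_def)
      show "norm (?f w) < 1" if "norm w < 1" for w
        using bd[OF mH[OF that]] \<open>M' > M\<close> M' by (simp add: norm_divide)
    qed
    then show ?thesis using mz M' by (simp add: norm_divide field_simps)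
  qed
  have "norm (g z) \<le> M * norm \<zeta> + e" if "e > 0" for e
  proof -
    have "norm (g z) \<le> (M + e) * norm \<zeta>" using * that by simp
    also have "\<dots> \<le> M * norm \<zeta> + e" using z1 that by (simp add: algebra_simps mult_left_le)
    finally show ?thesis .
  qed
  then show ?thesis unfolding \<zeta>_def by (rule field_le_epsilon)
qed

text \<open>Zeros are divided out one at a time. By the previous lemma the quotient by one Blaschke
  factor obeys the same bound M, so the induction loses nothing.\<close>

lemma holomorphic_uhp_le_finite_blaschke:
  assumes "finite S" and "S \<subseteq> \<H>"
    and "g holomorphic_on \<H>" and "\<And>z. z \<in> \<H> \<Longrightarrow> norm (g z) \<le> M"
    and "\<And>a. a \<in> S \<Longrightarrow> g a = 0" and "z \<in> \<H>"
  shows "norm (g z) \<le> M * (\<Prod>a\<in>S. norm (blaschke_factor a z))"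
  using assms
proof (induction S arbitrary: g z rule: finite_induct)
  case empty
  then show ?case by simp
next
  case (insert a S)
  note hol = insert.prems(2) and bd = insert.prems(3)
  have a: "a \<in> \<H>" "g a = 0" using insert.prems by auto
  \<comment> \<open>This is g divided by \<open>blaschke_factor a\<close>, with the removable
    singularity at a filled in.\<close>
  define g1 where "g1 w = (if w = a then deriv g a else (g w - g a) / (w - a)) * (w - cnj a)" for w
  have hol1: "g1 holomorphic_on \<H>"
    unfolding g1_def by (intro holomorphic_intros pole_lemma_open[OF hol open_uhp])
  have eq: "g w = g1 w * blaschke_factor a w" if "w \<in> \<H>" for w
    unfolding g1_def blaschke_factor_def using uhp_diff_cnj_nz[of a w] that a by auto
  have bd0: "norm (g1 w) \<le> M" if "w \<in> \<H>" "w \<noteq> a" for w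
  proof -
    have nz: "norm (blaschke_factor a w) > 0"
      unfolding blaschke_factor_def using that a uhp_diff_cnj_nz[of a w] by auto
    have "norm (g1 w) * norm (blaschke_factor a w) \<le> M * norm (blaschke_factor a w)"
      using holomorphic_uhp_le_blaschke[OF hol bd a that(1)] eq[OF that(1)] by (simp add: norm_mult)
    then show ?thesis using nz by simp
  qed
  \<comment> \<open>The Blaschke factor vanishes at a, so there the bound on \<open>g1\<close> can
    only come by continuity.\<close>
  have "isCont g1 a"
    using hol1 open_uhp a(1) by (meson continuous_on_eq_continuous_at holomorphic_on_imp_continuous_on)
  then have "((\<lambda>w. norm (g1 w)) \<longlongrightarrow> norm (g1 a)) (at a)"
    by (intro tendsto_norm) (simp add: isCont_def)
  moreover have "eventually (\<lambda>w. norm (g1 w) \<le> M) (at a)"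
    using eventually_at_in_open[OF open_uhp a(1)] by eventually_elim (use bd0 in auto)
  ultimately have "norm (g1 a) \<le> M"
    by (rule tendsto_upperbound) simp
  then have bd1: "norm (g1 w) \<le> M" if "w \<in> \<H>" for w
    using bd0 that by (cases "w = a") auto
  have zero1: "g1 b = 0" if "b \<in> S" for b
    using that insert.hyps insert.prems a unfolding g1_def by auto
  have "norm (g1 z) \<le> M * (\<Prod>a\<in>S. norm (blaschke_factor a z))"
    using insert.prems by (intro insert.IH hol1 bd1 zero1) auto
  then have "norm (g1 z) * norm (blaschke_factor a z)
      \<le> M * (\<Prod>a\<in>S. norm (blaschke_factor a z)) * norm (blaschke_factor a z)"
    by (rule mult_right_mono) simp
  then show ?case
    using insert.hyps eq[OF insert.prems(5)] by (simp add: norm_mult mult_ac)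
qed

text \<open>Each squared factor is at most exp (-c s n), so N zeros force |g z|^2 \<le> M^2 exp (-c
  (s 0 + ... + s (N-1))), which tends to 0 when the series diverges. Injectivity makes the zeros
  distinct, as the finite product needs.\<close>

lemma holomorphic_uhp_eq_0_if_not_blaschke:
  fixes \<omega> :: "nat \<Rightarrow> complex"
  assumes hol: "g holomorphic_on \<H>" and bd: "\<And>z. z \<in> \<H> \<Longrightarrow> norm (g z) \<le> M"
    and inj: "inj \<omega>" and \<omega>: "\<And>n. \<omega> n \<in> \<H>" "\<And>n. norm (\<omega> n) \<ge> 1" "\<And>n. g (\<omega> n) = 0"
    and div: "\<not> summable (\<lambda>n. Im (\<omega> n) / (norm (\<omega> n))\<^sup>2)"
    and z: "z \<in> \<H>"
  shows "g z = 0"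
proof -
  \<comment> \<open>Comes from |z - cnj a|^2 \<le> 2 (|z|^2 + 1) |a|^2, which is where |a| \<ge> 1
    enters.\<close>
  define c where "c = 2 * Im z / ((norm z)\<^sup>2 + 1)"
  have c: "c > 0" unfolding c_def using z by (simp add: add_nonneg_pos)
  define s where "s n = Im (\<omega> n) / (norm (\<omega> n))\<^sup>2" for n
  have s0: "s n \<ge> 0" for n unfolding s_def using \<omega>(1)[of n] by simp
  have M0: "M \<ge> 0" using bd[OF z] norm_ge_zero order_trans by blast
  have fac: "(norm (blaschke_factor (\<omega> n) z))\<^sup>2 \<le> exp (- c * s n)" for n
  proof -
    let ?a = "\<omega> n"
    have nz: "(norm (z - cnj ?a))\<^sup>2 > 0" using uhp_diff_cnj_nz[of ?a z] \<omega>(1)[of n] z by simp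
    have "norm (z - cnj ?a) \<le> norm z + norm ?a" using norm_triangle_ineq4[of z "cnj ?a"] by simp
    then have "(norm (z - cnj ?a))\<^sup>2 \<le> (norm z + norm ?a)\<^sup>2" by (simp add: power_mono)
    also have "\<dots> \<le> 2 * (norm z)\<^sup>2 + 2 * (norm ?a)\<^sup>2" using sum_squares_bound[of "norm z" "norm ?a"]
      by (simp add: power2_sum)
    also have "\<dots> \<le> 2 * ((norm z)\<^sup>2 * (norm ?a)\<^sup>2) + 2 * (norm ?a)\<^sup>2"
      using \<omega>(2)[of n] by (simp add: mult_left_le mult_le_cancel_left1)
    finally have le: "(norm (z - cnj ?a))\<^sup>2 \<le> 2 * ((norm z)\<^sup>2 + 1) * (norm ?a)\<^sup>2" by (simp add: algebra_simps)
    have "c * s n = 4 * Im ?a * Im z / (2 * ((norm z)\<^sup>2 + 1) * (norm ?a)\<^sup>2)"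
      unfolding c_def s_def using add_nonneg_pos[OF zero_le_power2[of "norm z"] zero_less_one]
      by (simp add: divide_simps)
    also have "\<dots> \<le> 4 * Im ?a * Im z / (norm (z - cnj ?a))\<^sup>2"
    proof (rule divide_left_mono[OF le])
      show "0 \<le> 4 * Im ?a * Im z" using z \<omega>(1)[of n] by simp
      have "2 * ((norm z)\<^sup>2 + 1) * (norm ?a)\<^sup>2 > 0" using nz le by linarith
      then show "0 < 2 * ((norm z)\<^sup>2 + 1) * (norm ?a)\<^sup>2 * (norm (z - cnj ?a))\<^sup>2"
        using nz by (rule mult_pos_pos)
    qed
    finally have "c * s n \<le> 4 * Im ?a * Im z / (norm (z - cnj ?a))\<^sup>2" .
    then have "(norm (blaschke_factor ?a z))\<^sup>2 \<le> 1 - c * s n"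
      using norm_blaschke_factor_sq[of ?a z] z \<omega>(1)[of n] by simp
    also have "\<dots> \<le> exp (- c * s n)" using exp_ge_add_one_self[of "- c * s n"] by simp
    finally show ?thesis .
  qed
  have bound: "(norm (g z))\<^sup>2 \<le> M\<^sup>2 * exp (- c * (\<Sum>n<N. s n))" for N
  proof -
    have "norm (g z) \<le> M * (\<Prod>a\<in>\<omega> ` {..<N}. norm (blaschke_factor a z))"
      using \<omega> z by (intro holomorphic_uhp_le_finite_blaschke[OF _ _ hol bd]) auto
    also have "(\<Prod>a\<in>\<omega> ` {..<N}. norm (blaschke_factor a z)) = (\<Prod>n<N. norm (blaschke_factor (\<omega> n) z))"
      by (subst prod.reindex) (use inj in \<open>auto intro: inj_on_subset\<close>)
    finally have "(norm (g z))\<^sup>2 \<le> (M * (\<Prod>n<N. norm (blaschke_factor (\<omega> n) z)))\<^sup>2"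
      by (simp add: power_mono)
    also have "\<dots> = M\<^sup>2 * (\<Prod>n<N. (norm (blaschke_factor (\<omega> n) z))\<^sup>2)"
      by (simp add: power_mult_distrib prod_power_distrib)
    also have "\<dots> \<le> M\<^sup>2 * (\<Prod>n<N. exp (- c * s n))"
      by (intro mult_left_mono prod_mono) (use fac in auto)
    also have "(\<Prod>n<N. exp (- c * s n)) = exp (- c * (\<Sum>n<N. s n))"
      by (simp add: exp_sum sum_distrib_left)
    finally show ?thesis .
  qed
  show ?thesis
  proof (rule ccontr)
    assume "g z \<noteq> 0"
    then have gz: "(norm (g z))\<^sup>2 > 0" by simp
    have "(\<Sum>n<N. s n) \<le> ln (M\<^sup>2 / (norm (g z))\<^sup>2) / c" for N
    proof -
      have "M\<^sup>2 > 0" using bound[of N] gz by (smt (verit) exp_gt_zero mult_nonpos_nonneg zero_le_power2)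
      have "exp (c * (\<Sum>n<N. s n)) * (norm (g z))\<^sup>2
          \<le> exp (c * (\<Sum>n<N. s n)) * (M\<^sup>2 * exp (- c * (\<Sum>n<N. s n)))"
        by (intro mult_left_mono bound) auto
      also have "\<dots> = M\<^sup>2" by (simp add: exp_minus)
      finally have "exp (c * (\<Sum>n<N. s n)) \<le> M\<^sup>2 / (norm (g z))\<^sup>2" using gz by (simp add: field_simps)
      then have "c * (\<Sum>n<N. s n) \<le> ln (M\<^sup>2 / (norm (g z))\<^sup>2)"
        using gz \<open>M\<^sup>2 > 0\<close> by (subst ln_ge_iff) auto
      then show ?thesis using c by (simp add: field_simps)
    qed
    from this[of "Suc _"] have "summable s"
      by (intro bounded_imp_summable[OF s0]) (simp add: lessThan_Suc_atMost)
    then show False using div unfolding s_def by simp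
  qed
qed

text \<open>A holomorphic self-map does not increase pseudohyperbolic distance, and that of i and i
  L is (L - 1) / (L + 1). Under this constraint the ratio of the imaginary parts of the images is at
  most L.\<close>

lemma schwarz_pick_uhp_axis:
  assumes hol: "f holomorphic_on \<H>" and map: "\<And>z. z \<in> \<H> \<Longrightarrow> f z \<in> \<H>" and L: "L \<ge> 1"
  shows "Im (f \<i>) \<ge> Im (f (\<i> * of_real L)) / L"
proof -
  define w where "w = f \<i>"
  define v where "v = f (\<i> * of_real L)"
  have pos: "Im w > 0" "Im v > 0" unfolding w_def v_def using map[of \<i>] map[of "\<i> * of_real L"] L by auto
  have "norm (blaschke_factor w v) \<le> 1 * norm (blaschke_factor \<i> (\<i> * of_real L))"
    unfolding v_def
  proof (rule holomorphic_uhp_le_blaschke[where g = "\<lambda>z. blaschke_factor w (f z)"])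
    show "(\<lambda>z. blaschke_factor w (f z)) holomorphic_on \<H>"
      unfolding blaschke_factor_def using uhp_diff_cnj_nz[OF pos(1)] map
      by (intro holomorphic_intros hol) auto
    show "norm (blaschke_factor w (f z)) \<le> 1" if "z \<in> \<H>" for z
      using norm_blaschke_factor_less_1[OF pos(1)] map[OF that] by (simp add: less_imp_le)
  qed (use L in \<open>auto simp: w_def blaschke_factor_def\<close>)
  also have "norm (blaschke_factor \<i> (\<i> * of_real L)) = (L - 1) / (L + 1)"
  proof -
    have "blaschke_factor \<i> (\<i> * of_real L) = of_real ((L - 1) / (L + 1))"
    proof -
      have "\<i> * complex_of_real L - \<i> = \<i> * of_real (L - 1)"
        "\<i> * complex_of_real L - cnj \<i> = \<i> * of_real (L + 1)" by (simp_all add: algebra_simps)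
      then show ?thesis unfolding blaschke_factor_def by simp
    qed
    then show ?thesis using L by (simp only: norm_of_real) simp
  qed
  finally have le: "norm (v - w) \<le> (L - 1) / (L + 1) * norm (v - cnj w)"
    using uhp_diff_cnj_nz[OF pos] by (simp add: blaschke_factor_def norm_divide field_simps)
  have "(L + 1) * norm (v - w) \<le> (L - 1) * norm (v - cnj w)"
    using le L by (simp add: field_simps)
  then have "((L + 1) * norm (v - w))\<^sup>2 \<le> ((L - 1) * norm (v - cnj w))\<^sup>2"
    using L by (intro power_mono) auto
  then have "(L + 1)\<^sup>2 * ((Re v - Re w)\<^sup>2 + (Im v - Im w)\<^sup>2) \<le> (L - 1)\<^sup>2 * ((Re v - Re w)\<^sup>2 + (Im v + Im w)\<^sup>2)"
    by (simp add: power_mult_distrib cmod_power2)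
  \<comment> \<open>A difference of real parts only tightens the constraint, so it may be
    dropped.\<close>
  moreover have "(L - 1)\<^sup>2 * (Re v - Re w)\<^sup>2 \<le> (L + 1)\<^sup>2 * (Re v - Re w)\<^sup>2"
    using L by (intro mult_right_mono power_mono) auto
  ultimately have "((L + 1) * (Im v - Im w))\<^sup>2 \<le> ((L - 1) * (Im v + Im w))\<^sup>2"
    unfolding power_mult_distrib distrib_left[of "(L + 1)\<^sup>2"] distrib_left[of "(L - 1)\<^sup>2"] by linarith
  then have "(L + 1) * (Im v - Im w) \<le> (L - 1) * (Im v + Im w)"
    by (rule power2_le_imp_le) (use L pos in auto)
  then have "Im v \<le> L * Im w" by (simp add: algebra_simps)
  then show ?thesis using L unfolding v_def w_def by (simp add: field_simps)
qed

section \<open>Cauchy laws and the Poisson formula\<close>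

text \<open>In t this is the Cauchy density with location \<open>Re z\<close> and scale
  \<open>Im z\<close>; in z it is the Poisson kernel of the half-plane.\<close>

definition poisson :: "complex \<Rightarrow> real \<Rightarrow> real" where
  "poisson z t = Im z / (pi * ((t - Re z)\<^sup>2 + (Im z)\<^sup>2))"

definition cauchy_distr :: "complex \<Rightarrow> real measure" where
  "cauchy_distr z = density lborel (\<lambda>t. ennreal (poisson z t))"

lemma poisson_pos: "Im z > 0 \<Longrightarrow> poisson z t > 0"
  unfolding poisson_def by (auto intro!: divide_pos_pos mult_pos_pos add_nonneg_pos)

lemma poisson_nonneg: "Im z > 0 \<Longrightarrow> poisson z t \<ge> 0"
  using poisson_pos less_imp_le by blast

lemma poisson_measurable [measurable]: "poisson z \<in> borel_measurable borel"
  unfolding poisson_def by measurable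

lemma sets_cauchy_distr [simp, measurable_cong]: "sets (cauchy_distr z) = sets borel"
  and space_cauchy_distr [simp]: "space (cauchy_distr z) = UNIV"
  by (simp_all add: cauchy_distr_def)

lemma has_bochner_integral_poisson:
  assumes "Im z > 0"
  shows "has_bochner_integral lborel (poisson z) 1"
proof -
  have e: "einterval (-\<infinity>) \<infinity> = UNIV" by (auto simp: einterval_def)
  have i: "integrable lborel (\<lambda>x::real. inverse (1 + x\<^sup>2))"
    and v: "(\<integral>x. inverse (1 + x\<^sup>2) \<partial>lborel) = pi"
    using integrable_inverse_1_plus_square LBINT_inverse_1_plus_square
    by (simp_all add: e interval_lebesgue_integral_def set_integrable_def set_lebesgue_integral_def)
  have eq: "poisson z (Re z + Im z * s) = 1 / (pi * Im z) * inverse (1 + s\<^sup>2)" for s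
  proof -
    have "(Re z + Im z * s - Re z)\<^sup>2 + (Im z)\<^sup>2 = (Im z)\<^sup>2 * (1 + s\<^sup>2)" by (simp add: algebra_simps)
    then show ?thesis using assms unfolding poisson_def by (simp add: power2_eq_square inverse_eq_divide)
  qed
  have "integrable lborel (\<lambda>s. poisson z (Re z + Im z * s))"
    unfolding eq using i by simp
  then have 1: "integrable lborel (poisson z)"
    using assms by (subst (asm) lborel_integrable_real_affine_iff) auto
  have "(\<integral>t. poisson z t \<partial>lborel) = Im z * (\<integral>s. poisson z (Re z + Im z * s) \<partial>lborel)"
    using lborel_integral_real_affine[of "Im z" "poisson z" "Re z"] assms by simp
  also have "\<dots> = 1" unfolding eq using v assms by simp
  finally show ?thesis using 1 by (simp add: has_bochner_integral_iff)
qed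

lemma integrable_poisson: "Im z > 0 \<Longrightarrow> integrable lborel (poisson z)"
  and integral_poisson: "Im z > 0 \<Longrightarrow> (\<integral>t. poisson z t \<partial>lborel) = 1"
  using has_bochner_integral_poisson by (auto simp: has_bochner_integral_iff)

lemma real_distribution_cauchy:
  assumes "Im z > 0"
  shows "real_distribution (cauchy_distr z)"
proof -
  have "emeasure (cauchy_distr z) UNIV = 1"
    unfolding cauchy_distr_def
    using assms by (simp add: emeasure_density nn_integral_eq_integral integrable_poisson
        integral_poisson poisson_nonneg)
  then have "prob_space (cauchy_distr z)" by (intro prob_spaceI) simp
  then show ?thesis by (simp add: real_distribution_def real_distribution_axioms_def)
qed

lemma integrable_poisson_mult:
  fixes h :: "real \<Rightarrow> complex"
  assumes "Im z > 0" "h \<in> borel_measurable borel" "AE t in lborel. norm (h t) \<le> M"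
  shows "integrable lborel (\<lambda>t. poisson z t *\<^sub>R h t)"
proof (rule Bochner_Integration.integrable_bound)
  show "integrable lborel (\<lambda>t. M * poisson z t)" using integrable_poisson assms by simp
  show "(\<lambda>t. poisson z t *\<^sub>R h t) \<in> borel_measurable lborel" using assms(2) by measurable
  show "AE t in lborel. norm (poisson z t *\<^sub>R h t) \<le> norm (M * poisson z t)"
    using assms(3)
  proof eventually_elim
    case (elim t)
    then have "poisson z t * norm (h t) \<le> poisson z t * M"
      using poisson_nonneg[OF assms(1)] by (intro mult_left_mono)
    then show ?case using poisson_nonneg[OF assms(1), of t] by (simp add: mult.commute)
  qed
qed

text \<open>Subtracting the constant \<open>h z\<close> first makes the singularity at z removable,
  so Cauchy's theorem suffices without residues. On the half-circle of radius R the integrand is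
  O(R^-2), so the arc contributes O(1/R).\<close>

lemma poisson_formula_closed:
  assumes e: "e > 0" and hol: "h holomorphic_on {z. Im z > -e}"
    and bd: "\<And>z. Im z > -e \<Longrightarrow> norm (h z) \<le> M" and z: "Im z > 0"
  shows "(\<integral>t. poisson z t *\<^sub>R h (of_real t) \<partial>lborel) = h z"
proof -
  define y where "y = Im z"
  \<comment> \<open>The bound by y keeps \<open>cnj z\<close>, the other pole of the kernel, outside
    \<open>S\<close>.\<close>
  define d where "d = min e y"
  define S where "S = {w. Im w > -d}"
  have S: "open S" "convex S"
    unfolding S_def by (simp_all add: open_halfspace_Im_gt convex_halfspace_Im_gt)
  have hS: "h holomorphic_on S" using hol by (rule holomorphic_on_subset) (auto simp: S_def d_def)
  \<comment> \<open>On the real line the two denominators multiply to |t - z|^2, so \<open>k\<close>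
    becomes 2 pi i times the Poisson kernel times h t - h z.\<close>
  define k where "k w = (if w = z then deriv h z else (h w - h z) / (w - z)) * (2 * \<i> * y / (w - cnj z))" for w
  have kS: "k holomorphic_on S"
    unfolding k_def using e z
    by (intro holomorphic_intros pole_lemma_open hS S) (auto simp: S_def d_def y_def)
  have kreal: "k (of_real t) = (2 * pi * \<i>) * (poisson z t *\<^sub>R (h (of_real t) - h z))" for t
  proof -
    have nz: "of_real t \<noteq> z" "of_real t \<noteq> cnj z" using z by (auto simp: complex_eq_iff)
    have p: "((t - Re z)\<^sup>2 + y\<^sup>2) > 0" using z by (auto simp: y_def intro!: add_nonneg_pos)
    have "(of_real t - z) * (of_real t - cnj z) = of_real ((t - Re z)\<^sup>2 + y\<^sup>2)"
      by (simp add: complex_eq_iff y_def power2_eq_square algebra_simps)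
    then have "k (of_real t) = (h (of_real t) - h z) * (2 * \<i> * y) / of_real ((t - Re z)\<^sup>2 + y\<^sup>2)"
      unfolding k_def using nz by (simp add: field_simps)
    also have "\<dots> = (2 * pi * \<i>) * (poisson z t *\<^sub>R (h (of_real t) - h z))"
      unfolding poisson_def y_def[symmetric] scaleR_conv_of_real using p
      by (simp add: divide_simps del: of_real_add of_real_power)
    finally show ?thesis .
  qed
  have hcont: "continuous_on UNIV (\<lambda>t. h (of_real t))"
    by (rule continuous_on_compose2[OF holomorphic_on_imp_continuous_on[OF hol]])
      (use e in \<open>auto intro!: continuous_intros\<close>)
  have hm [measurable]: "(\<lambda>t. h (of_real t)) \<in> borel_measurable borel"
    using borel_measurable_continuous_onI[OF hcont] .
  have hb: "norm (h (of_real t)) \<le> M" for t :: real using bd e by simp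
  have hz: "norm (h z) \<le> M" using bd e z by simp
  have M0: "M \<ge> 0" using hz norm_ge_zero order_trans by blast
  define K where "K t = k (of_real t)" for t :: real
  have Kint: "integrable lborel K"
    unfolding K_def kreal
  proof (intro integrable_mult_right integrable_poisson_mult z)
    have "norm (h (of_real t) - h z) \<le> 2 * M" for t :: real
      using norm_triangle_ineq4[of "h (of_real t)" "h z"] hb[of t] hz by linarith
    then show "AE t in lborel. norm (h (of_real t) - h z) \<le> 2 * M" by simp
  qed measurable
  have Kc: "continuous_on A K" for A
    unfolding K_def
    by (rule continuous_on_compose2[OF holomorphic_on_imp_continuous_on[OF kS]])
      (use e z in \<open>auto intro!: continuous_intros simp: S_def d_def y_def\<close>)
  have small: "norm (integral {-R..R} K) \<le> 4 * M * y * pi * (R / (R - norm z)\<^sup>2)"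
    if R: "R > norm z" for R
  proof -
    have R0: "R > 0" using R norm_ge_zero le_less_trans by blast
    let ?l = "linepath (of_real (-R)) (of_real R) :: real \<Rightarrow> complex" and ?c = "part_circlepath 0 R 0 pi"
    have pl: "path_image ?l \<subseteq> S"
    proof
      fix w assume "w \<in> path_image ?l"
      then show "w \<in> S" using e z unfolding S_def d_def y_def by (auto simp: linepath_def path_image_def)
    qed
    have pc: "norm w = R \<and> Im w \<ge> 0" if "w \<in> path_image ?c" for w
    proof -
      obtain t where "0 \<le> t" "t \<le> pi" "w = of_real R * cis t"
        using \<open>w \<in> path_image ?c\<close> by (auto simp: path_image_part_circlepath' closed_segment_eq_real_ivl)
      then show ?thesis using R0 by (auto simp: norm_mult sin_ge_zero)
    qed
    have pcS: "path_image ?c \<subseteq> S" using pc e z unfolding S_def d_def y_def by fastforce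
    have 0: "(k has_contour_integral 0) (?l +++ ?c)"
      by (rule Cauchy_theorem_convex_simple[OF kS S(2)])
        (use pl pcS in \<open>auto intro!: valid_path_join path_image_join_subset simp: path_image_join\<close>)
    have i1: "k contour_integrable_on ?l" and i2: "k contour_integrable_on ?c"
      using holomorphic_on_imp_continuous_on[OF kS] pl pcS
      by (auto intro!: contour_integrable_continuous_linepath contour_integrable_continuous_part_circlepath
          intro: continuous_on_subset)
    have "contour_integral ?l k + contour_integral ?c k = 0"
      using contour_integral_unique[OF 0] i1 i2 by simp
    then have eq: "contour_integral ?l k = - contour_integral ?c k" by (simp add: eq_neg_iff_add_eq_0)
    have l: "contour_integral ?l k = integral {-R..R} K"
      unfolding K_def using R0 by (subst contour_integral_linepath_Reals_eq) auto
    have "norm (contour_integral ?c k) \<le> (4 * M * y / (R - norm z)\<^sup>2) * R * \<bar>pi - 0\<bar>"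
    proof (rule contour_integral_bound_part_circlepath[OF i2])
      show "0 \<le> 4 * M * y / (R - norm z)\<^sup>2" using M0 z by (simp add: y_def)
      show "0 \<le> R" using R0 by simp
      fix w assume "w \<in> path_image ?c"
      note w = pc[OF this]
      have wz: "w \<noteq> z" using w R by auto
      have n1: "norm (w - z) \<ge> R - norm z" using w norm_triangle_ineq2[of w z] by simp
      have n2: "norm (w - cnj z) \<ge> R - norm z" using w norm_triangle_ineq2[of w "cnj z"] by simp
      have "norm (h w - h z) \<le> 2 * M"
        using norm_triangle_ineq4[of "h w" "h z"] bd[of w] hz w e by linarith
      then have "norm (h w - h z) * (2 * y) / (norm (w - z) * norm (w - cnj z)) \<le> (2 * M) * (2 * y) / ((R - norm z) * (R - norm z))"
        using n1 n2 R z M0 by (intro frac_le mult_mono mult_right_mono) (auto simp: y_def)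
      then show "norm (k w) \<le> 4 * M * y / (R - norm z)\<^sup>2"
        unfolding k_def using wz z by (simp add: norm_mult norm_divide y_def power2_eq_square)
    qed
    moreover have "norm (integral {-R..R} K) = norm (contour_integral ?c k)"
      by (metis eq l norm_minus_cancel)
    ultimately show ?thesis by (simp add: mult_ac)
  qed
  have conv: "(\<lambda>n. integral {- real n..real n} K) \<longlonglongrightarrow> (\<integral>t. K t \<partial>lborel)"
  proof -
    have "(\<lambda>n. \<integral>t. indicator {- real n..real n} t *\<^sub>R K t \<partial>lborel) \<longlonglongrightarrow> (\<integral>t. K t \<partial>lborel)"
    proof (rule integral_dominated_convergence[where w = "\<lambda>t. norm (K t)"])
      show "AE t in lborel. (\<lambda>n. indicator {- real n..real n} t *\<^sub>R K t) \<longlonglongrightarrow> K t"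
      proof (intro AE_I2 tendsto_eventually)
        fix t :: real
        show "eventually (\<lambda>n. indicator {- real n..real n} t *\<^sub>R K t = K t) sequentially"
          using eventually_ge_at_top[of "nat \<lceil>\<bar>t\<bar>\<rceil>"]
          by eventually_elim (auto simp: indicator_def abs_le_iff)
      qed
    qed (use Kint in \<open>auto simp: indicator_def\<close>)
    moreover have "(\<integral>t. indicator {- real n..real n} t *\<^sub>R K t \<partial>lborel) = integral {- real n..real n} K" for n
      using set_borel_integral_eq_integral(2)[of "{- real n..real n}" K]
        borel_integrable_compact[of "{- real n..real n}" K] Kc
      by (simp add: set_lebesgue_integral_def set_integrable_def indicator_scaleR_eq_if)
    ultimately show ?thesis by simp
  qed
  have "(\<lambda>n. integral {- real n..real n} K) \<longlonglongrightarrow> 0"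
  proof (rule Lim_null_comparison)
    show "eventually (\<lambda>n. norm (integral {- real n..real n} K) \<le> 4 * M * y * pi * (real n / (real n - norm z)\<^sup>2)) sequentially"
      using eventually_gt_at_top[of "nat \<lceil>norm z\<rceil>"]
      by eventually_elim (rule small, linarith)
    have "(\<lambda>n. real n / (real n - norm z)\<^sup>2) \<longlonglongrightarrow> 0" by real_asymp
    then show "(\<lambda>n. 4 * M * y * pi * (real n / (real n - norm z)\<^sup>2)) \<longlonglongrightarrow> 0"
      by (rule tendsto_mult_right_zero)
  qed
  then have "(\<integral>t. K t \<partial>lborel) = 0" using conv LIMSEQ_unique by blast
  moreover have "(\<integral>t. K t \<partial>lborel)
      = 2 * pi * \<i> * (\<integral>t. poisson z t *\<^sub>R (h (of_real t) - h z) \<partial>lborel)"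
    unfolding K_def kreal by (rule integral_mult_right_zero)
  ultimately have "(\<integral>t. poisson z t *\<^sub>R (h (of_real t) - h z) \<partial>lborel) = 0"
    by simp
  moreover have "(\<integral>t. poisson z t *\<^sub>R (h (of_real t) - h z) \<partial>lborel)
      = (\<integral>t. poisson z t *\<^sub>R h (of_real t) \<partial>lborel) - (\<integral>t. poisson z t *\<^sub>R h z \<partial>lborel)"
    unfolding scaleR_diff_right
    by (intro Bochner_Integration.integral_diff integrable_poisson_mult z) (use hb in \<open>auto\<close>)
  moreover have "(\<integral>t. poisson z t *\<^sub>R h z \<partial>lborel) = h z"
    using integrable_poisson[OF z] integral_poisson[OF z] by simp
  ultimately show ?thesis by simp
qed

text \<open>The closed version holds for h shifted down by any positive height. Letting the height
  tend to 0 through a sequence, boundedness of h gives dominated convergence, and boundary limits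
  almost everywhere are enough.\<close>

lemma poisson_formula:
  assumes hol: "h holomorphic_on \<H>" and bd: "\<And>z. z \<in> \<H> \<Longrightarrow> norm (h z) \<le> M"
    and [measurable]: "hb \<in> borel_measurable borel"
    and lim: "AE x in lborel. ((\<lambda>y. h (Complex x y)) \<longlongrightarrow> hb x) (at_right 0)"
    and z: "z \<in> \<H>"
  shows "(\<integral>t. poisson z t *\<^sub>R hb t \<partial>lborel) = h z"
proof -
  define e where "e n = inverse (real (Suc n))" for n
  have e: "e n > 0" for n by (simp add: e_def)
  have e0: "e \<longlonglongrightarrow> 0" unfolding e_def by (rule LIMSEQ_inverse_real_of_nat)
  have e_right: "filterlim e (at_right 0) sequentially"
    using e0 e by (simp add: filterlim_at less_imp_neq[THEN not_sym])
  have hcont: "isCont h w" if "w \<in> \<H>" for w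
    using hol open_uhp that by (meson continuous_on_eq_continuous_at holomorphic_on_imp_continuous_on)
  have eq: "(\<integral>t. poisson z t *\<^sub>R h (Complex t (e n)) \<partial>lborel) = h (z + \<i> * e n)" for n
  proof -
    have "(\<integral>t. poisson z t *\<^sub>R h (of_real t + \<i> * e n) \<partial>lborel) = h (z + \<i> * e n)"
    proof (rule poisson_formula_closed[where h = "\<lambda>w. h (w + \<i> * e n)" and M = M])
      have "(h \<circ> (\<lambda>w. w + \<i> * e n)) holomorphic_on {w. Im w > - e n}"
        by (rule holomorphic_on_compose_gen[OF _ hol]) (auto intro!: holomorphic_intros)
      then show "(\<lambda>w. h (w + \<i> * e n)) holomorphic_on {w. Im w > - e n}" by (simp add: comp_def)
    qed (use e bd z in auto)
    moreover have "of_real t + \<i> * e n = Complex t (e n)" for t by (simp add: complex_eq_iff)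
    ultimately show ?thesis by simp
  qed
  have [measurable]: "(\<lambda>t. h (Complex t (e n))) \<in> borel_measurable borel" for n
  proof (rule borel_measurable_continuous_onI)
    have "continuous_on UNIV (\<lambda>t. of_real t + \<i> * e n)" by (intro continuous_intros)
    then have "continuous_on UNIV (\<lambda>t. Complex t (e n))"
      by (simp add: Complex_eq)
    then show "continuous_on UNIV (\<lambda>t. h (Complex t (e n)))"
      by (rule continuous_on_compose2[OF holomorphic_on_imp_continuous_on[OF hol]]) (use e in auto)
  qed
  have "(\<lambda>n. \<integral>t. poisson z t *\<^sub>R h (Complex t (e n)) \<partial>lborel) \<longlonglongrightarrow> (\<integral>t. poisson z t *\<^sub>R hb t \<partial>lborel)"
  proof (rule integral_dominated_convergence[where w = "\<lambda>t. M * poisson z t"])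
    show "AE t in lborel. (\<lambda>n. poisson z t *\<^sub>R h (Complex t (e n))) \<longlonglongrightarrow> poisson z t *\<^sub>R hb t"
      using lim
      by eventually_elim (intro tendsto_intros filterlim_compose[OF _ e_right])
    show "AE t in lborel. norm (poisson z t *\<^sub>R h (Complex t (e n))) \<le> M * poisson z t" for n
    proof (rule AE_I2)
      fix t
      have "poisson z t * norm (h (Complex t (e n))) \<le> poisson z t * M"
        using bd[of "Complex t (e n)"] e[of n] poisson_nonneg[of z t] z by (intro mult_left_mono) auto
      then show "norm (poisson z t *\<^sub>R h (Complex t (e n))) \<le> M * poisson z t"
        using poisson_nonneg[of z t] z by (simp add: mult.commute)
    qed
  qed (use integrable_poisson z in auto)
  moreover have "(\<lambda>n. h (z + \<i> * e n)) \<longlonglongrightarrow> h (z + \<i> * of_real 0)"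
    by (intro isCont_tendsto_compose[OF hcont] tendsto_intros e0) (use z in auto)
  ultimately show ?thesis using eq LIMSEQ_unique by fastforce
qed

section \<open>Images of Cauchy laws under boundary maps\<close>

lemma (in real_distribution) char_minus: "char M (- s) = cnj (char M s)"
proof -
  have "iexp (- s * x) = cnj (iexp (s * x))" for x
    by (simp add: exp_cnj)
  then show ?thesis unfolding char_def by (simp only: Bochner_Integration.integral_cnj)
qed

text \<open>Needed because exp (i s F) is bounded on the half-plane only for s \<ge> 0.\<close>

lemma char_eq_if_nonneg:
  assumes "real_distribution M1" "real_distribution M2" "\<And>s. s \<ge> 0 \<Longrightarrow> char M1 s = char M2 s"
  shows "M1 = M2"
proof (rule Levy_uniqueness[OF assms(1,2)])
  have "char M1 s = char M2 s" for s
    using assms(3)[of s] assms(3)[of "-s"]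
      real_distribution.char_minus[OF assms(1), of "-s"] real_distribution.char_minus[OF assms(2), of "-s"]
    by (cases "s \<ge> 0") auto
  then show "char M1 = char M2" by blast
qed

text \<open>Kept abstract because it is also instantiated with the identity, which yields the
  characteristic function of the Cauchy law, and with affine maps, which rescale Cauchy
  laws.\<close>

locale boundary_map =
  fixes F :: "complex \<Rightarrow> complex" and T :: "real \<Rightarrow> real"
  assumes hol: "F holomorphic_on \<H>"
    and map: "z \<in> \<H> \<Longrightarrow> F z \<in> \<H>"
    and T_measurable [measurable]: "T \<in> borel_measurable borel"
    and boundary: "AE x in lborel. ((\<lambda>y. F (Complex x y)) \<longlongrightarrow> complex_of_real (T x)) (at_right 0)"
begin

lemma char_distr_cauchy:
  assumes z: "z \<in> \<H>" and s: "s \<ge> 0"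
  shows "char (distr (cauchy_distr z) borel T) s = exp (\<i> * s * F z)"
proof -
  have "char (distr (cauchy_distr z) borel T) s = (\<integral>t. iexp (s * T t) \<partial>cauchy_distr z)"
    unfolding char_def by (rule integral_distr) measurable
  also have "\<dots> = (\<integral>t. poisson z t *\<^sub>R iexp (s * T t) \<partial>lborel)"
    unfolding cauchy_distr_def using poisson_nonneg[of z] z
    by (intro integral_density) (auto intro!: AE_I2)
  also have "\<dots> = exp (\<i> * s * F z)"
  proof (rule poisson_formula[where h = "\<lambda>z. exp (\<i> * s * F z)", OF _ _ _ _ z])
    show "(\<lambda>z. exp (\<i> * s * F z)) holomorphic_on \<H>" by (intro holomorphic_intros hol)
    show "norm (exp (\<i> * s * F w)) \<le> 1" if "w \<in> \<H>" for w
      using map[OF that] s by simp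
    show "AE x in lborel. ((\<lambda>y. exp (\<i> * s * F (Complex x y))) \<longlongrightarrow> iexp (s * T x)) (at_right 0)"
      using boundary
      by eventually_elim (auto intro!: tendsto_eq_intros simp: mult.assoc)
  qed measurable
  finally show ?thesis .
qed

end

lemma char_cauchy:
  assumes "z \<in> \<H>" "s \<ge> 0"
  shows "char (cauchy_distr z) s = exp (\<i> * s * z)"
proof -
  interpret boundary_map "\<lambda>z. z" "\<lambda>x. x"
  proof
    show "AE x in lborel. (Complex x \<longlongrightarrow> complex_of_real x) (at_right 0)"
      unfolding Complex_eq by (auto intro!: AE_I2 tendsto_eq_intros)
  qed auto
  have "distr (cauchy_distr z) borel (\<lambda>x. x) = cauchy_distr z"
    by (rule distr_id2) simp
  then show ?thesis using char_distr_cauchy[OF assms] by simp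
qed

context boundary_map
begin

lemma distr_cauchy:
  assumes z: "z \<in> \<H>"
  shows "distr (cauchy_distr z) borel T = cauchy_distr (F z)"
proof (rule char_eq_if_nonneg)
  interpret P: real_distribution "cauchy_distr z" using real_distribution_cauchy z by auto
  show "real_distribution (distr (cauchy_distr z) borel T)" by (rule P.real_distribution_distr) measurable
  show "real_distribution (cauchy_distr (F z))" using real_distribution_cauchy map[OF z] by auto
qed (use char_distr_cauchy[OF z] char_cauchy[OF map[OF z]] in simp)

lemma emeasure_vimage_cauchy:
  assumes "z \<in> \<H>" "A \<in> sets borel"
  shows "emeasure (cauchy_distr z) (T -` A) = emeasure (cauchy_distr (F z)) A"
  using distr_cauchy[OF assms(1)] emeasure_distr[of T "cauchy_distr z" borel A] assms(2) by simp

end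

section \<open>Invariance of Lebesgue measure and conservativity\<close>

context boundary_map
begin

lemma funpow_uhp: "z \<in> \<H> \<Longrightarrow> (F ^^ n) z \<in> \<H>"
  by (induction n) (use map in auto)

lemma funpow_T_vimage_borel: "A \<in> sets borel \<Longrightarrow> (T ^^ n) -` A \<in> sets borel"
proof (induction n arbitrary: A)
  case (Suc n)
  have "T -` A \<in> sets borel" using measurable_sets[OF T_measurable Suc.prems] by simp
  moreover have "(T ^^ Suc n) -` A = (T ^^ n) -` (T -` A)" by auto
  ultimately show ?case using Suc.IH by metis
qed simp

lemma emeasure_funpow_vimage_cauchy:
  assumes "z \<in> \<H>" "A \<in> sets borel"
  shows "emeasure (cauchy_distr z) ((T ^^ n) -` A) = emeasure (cauchy_distr ((F ^^ n) z)) A"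
  using assms(2)
proof (induction n arbitrary: A)
  case (Suc n)
  have "T -` A \<in> sets borel" using measurable_sets[OF T_measurable Suc.prems] by simp
  then have "emeasure (cauchy_distr z) ((T ^^ n) -` (T -` A)) = emeasure (cauchy_distr ((F ^^ Suc n) z)) A"
    using Suc.IH[of "T -` A"] emeasure_vimage_cauchy[OF funpow_uhp[OF assms(1)] Suc.prems] by simp
  moreover have "(T ^^ Suc n) -` A = (T ^^ n) -` (T -` A)" by auto
  ultimately show ?case by metis
qed simp

end

lemma emeasure_cauchy_distr:
  "A \<in> sets borel \<Longrightarrow> emeasure (cauchy_distr z) A = (\<integral>\<^sup>+t. ennreal (poisson z t) * indicator A t \<partial>lborel)"
  unfolding cauchy_distr_def by (simp add: emeasure_density)

text \<open>The rescaled densities n^2 / (t^2 + n^2) increase to 1, so monotone convergence applies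
  to every Borel set. This generality matters: it will be used for a preimage under T whose measure
  is not yet known to be finite.\<close>

lemma emeasure_cauchy_distr_tendsto_lborel:
  assumes [measurable]: "S \<in> sets borel"
  shows "(\<lambda>n. ennreal (pi * real n) * emeasure (cauchy_distr (\<i> * of_nat n)) S) \<longlonglongrightarrow> emeasure lborel S"
proof -
  define f where "f n t = ennreal ((real n)\<^sup>2 / (t\<^sup>2 + (real n)\<^sup>2)) * indicator S t" for n t
  have [measurable]: "f n \<in> borel_measurable lborel" for n unfolding f_def by measurable
  have f: "ennreal (pi * real n) * emeasure (cauchy_distr (\<i> * of_nat n)) S = (\<integral>\<^sup>+t. f n t \<partial>lborel)" for n
    unfolding f_def emeasure_cauchy_distr[OF assms]
    by (subst nn_integral_cmult[symmetric])
      (auto intro!: nn_integral_cong simp: poisson_def power2_eq_square indicator_def simp flip: ennreal_mult')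
  have "(\<lambda>n. \<integral>\<^sup>+t. f n t \<partial>lborel) \<longlonglongrightarrow> (\<integral>\<^sup>+t. indicator S t \<partial>lborel)"
  proof (rule nn_integral_LIMSEQ)
    have "(real n)\<^sup>2 / (t\<^sup>2 + (real n)\<^sup>2) \<le> (real (Suc n))\<^sup>2 / (t\<^sup>2 + (real (Suc n))\<^sup>2)" for n t
    proof (cases "n = 0")
      case False
      then have pos: "t\<^sup>2 + (real n)\<^sup>2 > 0" "t\<^sup>2 + (real (Suc n))\<^sup>2 > 0" by (auto intro!: add_nonneg_pos)
      have "t\<^sup>2 * (real n)\<^sup>2 \<le> t\<^sup>2 * (real (Suc n))\<^sup>2" by (intro mult_left_mono power_mono) auto
      then show ?thesis using pos by (simp only: divide_le_eq le_divide_eq frac_le_eq) (simp add: field_simps)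
    qed simp
    then show "incseq f" unfolding f_def
      by (intro incseq_SucI le_funI mult_right_mono ennreal_leI) auto
    show "(\<lambda>n. f n t) \<longlonglongrightarrow> indicator S t" for t
    proof -
      have "(\<lambda>n. (real n)\<^sup>2 / (t\<^sup>2 + (real n)\<^sup>2)) \<longlonglongrightarrow> 1" by real_asymp
      then show ?thesis
        using tendsto_ennrealI by (cases "t \<in> S") (fastforce simp: f_def)+
    qed
  qed measurable
  then show ?thesis unfolding f by simp
qed

context boundary_map
begin

text \<open>Letac's theorem. Rescaled Cauchy laws with parameter tending to infinity vertically exhaust
  Lebesgue measure, and the limit hypothesis says that this is not affected by \<^term>\<open>F\<close>.\<close>

lemma distr_lborel:
  assumes Im_F: "\<And>z. z \<in> \<H> \<Longrightarrow> Im (F z) \<ge> Im z"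
    and lim: "(\<lambda>n. F (\<i> * of_nat n) / of_nat n) \<longlonglongrightarrow> \<i>"
  shows "distr lborel borel T = lborel"
proof (rule sym, rule lborel_eqI)
  fix l u :: real assume "\<And>b. b \<in> Basis \<Longrightarrow> l \<bullet> b \<le> u \<bullet> b"
  then have lu: "l \<le> u" by simp
  define S where "S = T -` {l<..<u}"
  have S: "S \<in> sets borel" unfolding S_def using measurable_sets[OF T_measurable, of "{l<..<u}"] by simp
  \<comment> \<open>In terms of \<open>w n\<close> the density of the Cauchy law at F (i n),
    multiplied by pi n, takes the form in \<open>f\<close>, whose pointwise limit on the interval is
    read off from the limit i of \<open>w\<close>.\<close>
  define w where "w n = F (\<i> * of_nat n) / of_nat n" for n
  define f where "f n t = ennreal (Im (w n) / ((t / real n - Re (w n))\<^sup>2 + (Im (w n))\<^sup>2)) * indicator {l<..<u} t" for n t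
  have [measurable]: "f n \<in> borel_measurable lborel" for n unfolding f_def by measurable
  have f: "ennreal (pi * real n) * emeasure (cauchy_distr (\<i> * of_nat n)) S = (\<integral>\<^sup>+t. f n t \<partial>lborel)"
    if n: "n > 0" for n
  proof -
    have z: "\<i> * of_nat n \<in> \<H>" using n by simp
    have w: "F (\<i> * of_nat n) = of_real (real n) * w n" using n by (simp add: w_def)
    have "pi * real n * poisson (F (\<i> * of_nat n)) t
      = Im (w n) / ((t / real n - Re (w n))\<^sup>2 + (Im (w n))\<^sup>2)" for t
    proof -
      have "(t - real n * Re (w n))\<^sup>2 + (real n * Im (w n))\<^sup>2
          = (real n)\<^sup>2 * ((t / real n - Re (w n))\<^sup>2 + (Im (w n))\<^sup>2)"
        using n by (simp add: power2_eq_square field_simps)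
      then show ?thesis using n unfolding w poisson_def by (simp add: power2_eq_square)
    qed
    then show ?thesis
      unfolding S_def emeasure_vimage_cauchy[OF z, of "{l<..<u}", simplified] f_def emeasure_cauchy_distr[of "{l<..<u}", simplified]
      by (subst nn_integral_cmult[symmetric])
        (auto intro!: nn_integral_cong simp: indicator_def simp flip: ennreal_mult')
  qed
  have w_lim: "w \<longlonglongrightarrow> \<i>" using lim by (simp add: w_def[abs_def])
  have Im_w: "Im (w n) \<ge> 1" if "n > 0" for n
    using Im_F[of "\<i> * of_nat n"] that by (simp add: w_def)
  have "(\<lambda>n. \<integral>\<^sup>+t. f n t \<partial>lborel) \<longlonglongrightarrow> (\<integral>\<^sup>+t. indicator {l<..<u} t \<partial>lborel)"
  proof (rule nn_integral_dominated_convergence[where w = "indicator {l<..<u}"])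
    \<comment> \<open>The densities need not be monotone here, so domination replaces monotonicity:
      Im w \<ge> 1 gives Im w \<le> (Im w)^2. For n = 0 the quotient is 0 by the convention for
      division by zero.\<close>
    have "Im (w n) / ((t / real n - Re (w n))\<^sup>2 + (Im (w n))\<^sup>2) \<le> 1" for n t
    proof (cases "n = 0")
      case False
      then have 1: "Im (w n) \<ge> 1" using Im_w by simp
      then have "Im (w n) \<le> (Im (w n))\<^sup>2" by (simp add: power2_eq_square)
      also have "\<dots> \<le> (t / real n - Re (w n))\<^sup>2 + (Im (w n))\<^sup>2" by simp
      finally show ?thesis by (intro divide_le_eq_1[THEN iffD2] disjI1) (use 1 in \<open>auto intro!: add_nonneg_pos\<close>)
    qed (simp add: w_def)
    then show "AE t in lborel. f n t \<le> indicator {l<..<u} t" for n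
      unfolding f_def by (intro AE_I2) (simp add: indicator_def)
    show "AE t in lborel. (\<lambda>n. f n t) \<longlonglongrightarrow> indicator {l<..<u} t"
    proof (rule AE_I2)
      fix t :: real
      have "(\<lambda>n. t / real n) \<longlonglongrightarrow> 0" by real_asymp
      then have "(\<lambda>n. Im (w n) / ((t / real n - Re (w n))\<^sup>2 + (Im (w n))\<^sup>2)) \<longlonglongrightarrow> Im \<i> / ((0 - Re \<i>)\<^sup>2 + (Im \<i>)\<^sup>2)"
        by (intro tendsto_intros w_lim) auto
      then show "(\<lambda>n. f n t) \<longlonglongrightarrow> indicator {l<..<u} t"
        using tendsto_ennrealI by (cases "t \<in> {l<..<u}") (fastforce simp: f_def)+
    qed
  qed (use lu in auto)
  then have "(\<lambda>n. \<integral>\<^sup>+t. f n t \<partial>lborel) \<longlonglongrightarrow> ennreal (u - l)" using lu by simp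
  moreover have "(\<lambda>n. \<integral>\<^sup>+t. f n t \<partial>lborel) \<longlonglongrightarrow> emeasure lborel S"
    by (rule Lim_transform_eventually[OF emeasure_cauchy_distr_tendsto_lborel[OF S]])
      (use f in \<open>auto intro!: eventually_mono[OF eventually_gt_at_top[of 0]]\<close>)
  ultimately have "emeasure lborel S = ennreal (u - l)" using LIMSEQ_unique by blast
  then show "emeasure (distr lborel borel T) (box l u) = ennreal (\<Prod>b\<in>Basis. (u - l) \<bullet> b)"
    by (simp add: emeasure_distr S_def box_real)
qed simp

lemma measure_preserving:
  assumes "\<And>z. z \<in> \<H> \<Longrightarrow> Im (F z) \<ge> Im z" "(\<lambda>n. F (\<i> * of_nat n) / of_nat n) \<longlonglongrightarrow> \<i>"
  shows "measure_preserving_map lborel T"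
  unfolding measure_preserving_map_def
proof (intro conjI ballI)
  fix A :: "real set" assume "A \<in> sets lborel"
  then show "emeasure lborel (T -` A \<inter> space lborel) = emeasure lborel A"
    using emeasure_distr[of T lborel borel A] distr_lborel[OF assms] by simp
qed simp

lemma conservative_if_orbit_not_summable:
  assumes Im_F: "\<And>z. z \<in> \<H> \<Longrightarrow> Im (F z) \<ge> Im z"
    and div: "\<not> summable (\<lambda>n. Im ((F ^^ n) \<i>) / (norm ((F ^^ n) \<i>))\<^sup>2)"
  shows "conservative lborel T"
  unfolding conservative_def
proof (intro ballI impI)
  fix W :: "real set" assume "W \<in> sets lborel" and disj: "disjoint_family (\<lambda>n. (T ^^ n) -` W \<inter> space lborel)"
  then have W [measurable]: "W \<in> sets borel" by simp
  define z where "z n = (F ^^ n) \<i>" for n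
  have zH: "z n \<in> \<H>" for n unfolding z_def by (rule funpow_uhp) simp
  have Im_z: "Im (z n) \<ge> 1" for n
  proof (induction n)
    case (Suc n)
    then show ?case using Im_F[OF zH[of n]] by (simp add: z_def)
  qed (simp add: z_def)
  interpret P: real_distribution "cauchy_distr \<i>" by (rule real_distribution_cauchy) simp
  have eq: "measure (cauchy_distr \<i>) ((T ^^ n) -` W) = measure (cauchy_distr (z n)) W" for n
    unfolding measure_def z_def by (subst emeasure_funpow_vimage_cauchy) auto
  have "(\<lambda>n. measure (cauchy_distr \<i>) ((T ^^ n) -` W)) sums measure (cauchy_distr \<i>) (\<Union>n. (T ^^ n) -` W)"
    by (rule P.finite_measure_UNION) (use disj funpow_T_vimage_borel[OF W] in auto)
  then have sum: "summable (\<lambda>n. measure (cauchy_distr (z n)) W)" unfolding eq by (rule sums_summable)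
  \<comment> \<open>Only on a bounded window is the Poisson kernel bounded below uniformly in t, so
    W is treated piece by piece.\<close>
  have null: "emeasure lborel (W \<inter> {- real m..real m}) = 0" for m :: nat
  proof (rule ccontr)
    let ?V = "W \<inter> {- real m..real m}"
    assume "emeasure lborel ?V \<noteq> 0"
    have "emeasure lborel ?V \<le> emeasure lborel {- real m..real m}" by (intro emeasure_mono) auto
    then have fin: "emeasure lborel ?V < \<infinity>" using le_less_trans by fastforce
    then have V: "measure lborel ?V > 0" "emeasure lborel ?V = ennreal (measure lborel ?V)"
      using \<open>emeasure lborel ?V \<noteq> 0\<close> by (auto simp: emeasure_eq_ennreal_measure measure_eq_emeasure_eq_ennreal zero_less_measure_iff)
    \<comment> \<open>For |t| \<le> m and |z| \<ge> 1 one has |t - z|^2 \<le> 2 m^2 + 2 |z|^2 \<le>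
      (2 m^2 + 2) |z|^2.\<close>
    define \<kappa> where "\<kappa> = 1 / (pi * (2 * (real m)\<^sup>2 + 2))"
    have \<kappa>: "\<kappa> > 0" unfolding \<kappa>_def by (auto intro!: divide_pos_pos mult_pos_pos add_nonneg_pos)
    have low: "\<kappa> * (Im (z n) / (norm (z n))\<^sup>2) * measure lborel ?V \<le> measure (cauchy_distr (z n)) W" for n
    proof -
      interpret Q: real_distribution "cauchy_distr (z n)" by (rule real_distribution_cauchy) (use zH in auto)
      have n1: "(norm (z n))\<^sup>2 \<ge> 1" using Im_z[of n] abs_Im_le_cmod[of "z n"] by (simp add: power2_ge_1_iff)
      have p: "\<kappa> * (Im (z n) / (norm (z n))\<^sup>2) \<le> poisson (z n) t" if "\<bar>t\<bar> \<le> real m" for t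
      proof -
        have t: "t\<^sup>2 \<le> (real m)\<^sup>2" using that by (simp add: abs_le_square_iff[symmetric])
        have "(t - Re (z n))\<^sup>2 \<le> 2 * t\<^sup>2 + 2 * (Re (z n))\<^sup>2"
          using zero_le_power2[of "t + Re (z n)"] by (simp add: power2_eq_square algebra_simps)
        then have "(t - Re (z n))\<^sup>2 + (Im (z n))\<^sup>2 \<le> 2 * (real m)\<^sup>2 * 1 + 2 * (norm (z n))\<^sup>2"
          using t unfolding cmod_power2 by (simp add: algebra_simps) (smt (verit) zero_le_power2)
        also have "\<dots> \<le> 2 * (real m)\<^sup>2 * (norm (z n))\<^sup>2 + 2 * (norm (z n))\<^sup>2"
          by (intro add_right_mono mult_left_mono n1) auto
        finally have le: "(t - Re (z n))\<^sup>2 + (Im (z n))\<^sup>2 \<le> (2 * (real m)\<^sup>2 + 2) * (norm (z n))\<^sup>2"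
          by (simp add: algebra_simps)
        have pos: "0 < (t - Re (z n))\<^sup>2 + (Im (z n))\<^sup>2"
          using Im_z[of n] by (intro add_nonneg_pos) auto
        have "Im (z n) / (pi * ((2 * (real m)\<^sup>2 + 2) * (norm (z n))\<^sup>2)) \<le> poisson (z n) t"
          unfolding poisson_def using Im_z[of n] le pos
          by (intro divide_left_mono mult_left_mono mult_pos_pos) (auto intro!: add_nonneg_pos)
        then show ?thesis unfolding \<kappa>_def by (simp add: mult.assoc)
      qed
      let ?c = "\<kappa> * (Im (z n) / (norm (z n))\<^sup>2)"
      have c0: "?c \<ge> 0" using \<kappa> Im_z[of n] by simp
      have "ennreal (?c * measure lborel ?V) = ennreal ?c * emeasure lborel ?V"
        unfolding V(2) by (rule ennreal_mult[OF c0 measure_nonneg])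
      also have "\<dots> = (\<integral>\<^sup>+t. ennreal ?c * indicator ?V t \<partial>lborel)"
        by (simp add: nn_integral_cmult)
      also have "\<dots> \<le> (\<integral>\<^sup>+t. ennreal (poisson (z n) t) * indicator W t \<partial>lborel)"
        using p by (intro nn_integral_mono) (auto simp: indicator_def abs_le_iff intro!: ennreal_leI)
      also have "\<dots> = ennreal (measure (cauchy_distr (z n)) W)"
        by (rule trans[OF emeasure_cauchy_distr[OF W, symmetric] Q.emeasure_eq_measure])
      finally show ?thesis by simp
    qed
    have "summable (\<lambda>n. \<kappa> * (Im (z n) / (norm (z n))\<^sup>2) * measure lborel ?V)"
    proof (rule summable_comparison_test_ev[OF _ sum], intro always_eventually allI)
      fix n show "norm (\<kappa> * (Im (z n) / (norm (z n))\<^sup>2) * measure lborel ?V) \<le> measure (cauchy_distr (z n)) W"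
        using low[of n] \<kappa> Im_z[of n] by (simp add: abs_mult)
    qed
    then have "summable (\<lambda>n. (\<kappa> * measure lborel ?V) * (Im (z n) / (norm (z n))\<^sup>2))"
      by (simp add: mult_ac)
    then have "summable (\<lambda>n. Im (z n) / (norm (z n))\<^sup>2)"
      using \<kappa> V(1) by (subst (asm) summable_cmult_iff) auto
    then show False using div by (simp add: z_def)
  qed
  have "W = (\<Union>m. W \<inter> {- real m..real m})"
  proof safe
    fix t assume "t \<in> W"
    then have "t \<in> W \<inter> {- real (nat \<lceil>\<bar>t\<bar>\<rceil>)..real (nat \<lceil>\<bar>t\<bar>\<rceil>)}" by (auto simp: abs_le_iff) linarith+
    then show "t \<in> (\<Union>m. W \<inter> {- real m..real m})" by blast
  qed
  moreover have "emeasure lborel (\<Union>m. W \<inter> {- real m..real m}) = 0"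
    by (rule emeasure_UN_eq_0) (use null in auto)
  ultimately show "emeasure lborel W = 0" by simp
qed

end

section \<open>Ergodicity\<close>

lemma norm_diff_of_real_ge_Im: "Im z > 0 \<Longrightarrow> norm (z - complex_of_real t) \<ge> Im z"
  using abs_Im_le_cmod[of "z - of_real t"] by simp

lemma integrable_cauchy_kernel:
  assumes "finite_measure M" and [measurable_cong]: "sets M = sets borel" and z: "Im z > 0"
  shows "integrable M (\<lambda>t. 1 / (z - complex_of_real t))"
proof -
  interpret finite_measure M by fact
  show ?thesis
  proof (rule integrable_const_bound)
    show "AE t in M. norm (1 / (z - complex_of_real t)) \<le> 1 / Im z"
      using norm_diff_of_real_ge_Im[OF z] z by (auto simp: norm_divide intro!: AE_I2 divide_left_mono mult_pos_pos)
  qed measurable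
qed

text \<open>The difference quotient of the kernel differs from its derivative by (w - z) / ((w - t)
  (z - t)^2), which is O(|w - z|) uniformly in t, so it can be integrated directly.\<close>

lemma cauchy_transform_holomorphic:
  assumes "finite_measure M" and [measurable_cong]: "sets M = sets borel"
  shows "(\<lambda>z. \<integral>t. 1 / (z - complex_of_real t) \<partial>M) holomorphic_on \<H>"
proof -
  interpret finite_measure M by fact
  define G where "G z = (\<integral>t. 1 / (z - complex_of_real t) \<partial>M)" for z
  define G' where "G' z = (\<integral>t. - 1 / (z - complex_of_real t)\<^sup>2 \<partial>M)" for z
  have "(G has_field_derivative G' z) (at z)" if z: "z \<in> \<H>" for z
  proof -
    \<comment> \<open>Every w within distance y of z still has height above y.\<close>
    define y where "y = Im z / 2"
    have y: "y > 0" using z by (simp add: y_def)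
    define C where "C = measure M (space M) / y ^ 3"
    have int2: "integrable M (\<lambda>t. - 1 / (z - complex_of_real t)\<^sup>2)"
    proof (rule integrable_const_bound)
      have "norm (- 1 / (z - complex_of_real t)\<^sup>2) \<le> 1 / (Im z)\<^sup>2" for t
        using norm_diff_of_real_ge_Im[of z t] z
        by (auto simp: norm_divide norm_power intro!: divide_left_mono mult_pos_pos power_mono zero_less_power)
      then show "AE t in M. norm (- 1 / (z - complex_of_real t)\<^sup>2) \<le> 1 / (Im z)\<^sup>2" by simp
    qed measurable
    have bound: "norm ((G w - G z) / (w - z) - G' z) \<le> C * norm (w - z)"
      if w: "w \<noteq> z" "norm (w - z) < y" for w
    proof -
      have Im_w: "Im w > y" using w(2) abs_Im_le_cmod[of "w - z"] unfolding y_def by simp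
      then have Im_w0: "Im w > 0" using y by simp
      have i: "integrable M (\<lambda>t. 1 / (w - complex_of_real t))" "integrable M (\<lambda>t. 1 / (z - complex_of_real t))"
        using integrable_cauchy_kernel assms Im_w0 z by auto
      define d where "d t = (1 / (w - complex_of_real t) - 1 / (z - complex_of_real t)) / (w - z)
        - (- 1 / (z - complex_of_real t)\<^sup>2)" for t
      have "(G w - G z) / (w - z) - G' z = (\<integral>t. d t \<partial>M)"
        unfolding G_def G'_def d_def using i int2 by simp
      then have "norm ((G w - G z) / (w - z) - G' z) \<le> (\<integral>t. norm (d t) \<partial>M)"
        by (simp add: integral_norm_bound)
      also have "\<dots> \<le> (\<integral>t. norm (w - z) / y ^ 3 \<partial>M)"
      proof (rule integral_mono')
        fix t
        have n: "norm (w - of_real t) \<ge> y" "norm (z - of_real t) \<ge> y"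
          using norm_diff_of_real_ge_Im[OF Im_w0, of t] norm_diff_of_real_ge_Im[of z t] Im_w z
          by (auto simp: y_def)
        then have nz: "w - of_real t \<noteq> 0" "z - of_real t \<noteq> 0" using y by auto
        have "d t = (w - z) / ((w - of_real t) * (z - of_real t)\<^sup>2)"
          unfolding d_def using nz w(1) by (simp add: divide_simps) (simp add: power2_eq_square algebra_simps)
        moreover have "norm \<dots> \<le> norm (w - z) / y ^ 3"
          unfolding norm_divide norm_mult norm_power power3_eq_cube power2_eq_square mult.assoc
          using n y by (intro divide_left_mono mult_mono mult_pos_pos) auto
        ultimately show "norm (d t) \<le> norm (w - z) / y ^ 3"
          by simp
      qed (use y in auto)
      also have "\<dots> = C * norm (w - z)" by (simp add: C_def)
      finally show ?thesis .
    qed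
    have "((\<lambda>w. (G w - G z) / (w - z) - G' z) \<longlongrightarrow> 0) (at z)"
    proof (rule Lim_null_comparison)
      have "eventually (\<lambda>w. w \<noteq> z \<and> norm (w - z) < y) (at z)"
        using y by (auto simp: eventually_at dist_norm)
      then show "eventually (\<lambda>w. norm ((G w - G z) / (w - z) - G' z) \<le> C * norm (w - z)) (at z)"
        by eventually_elim (use bound in auto)
      show "((\<lambda>w. C * norm (w - z)) \<longlongrightarrow> 0) (at z)"
        by (auto intro!: tendsto_eq_intros)
    qed
    then show ?thesis by (simp add: has_field_derivative_iff Lim_null[symmetric])
  qed
  then show ?thesis
    unfolding G_def[symmetric] using open_uhp by (auto simp: holomorphic_on_open)
qed

text \<open>An analytic completion of the harmonic function \<open>z \<mapsto> P\<^sub>z(A)\<close>, the Cauchy measure of \<open>A\<close>: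
  with respect to \<open>P\<^sub>i\<close> the density of \<open>P\<^sub>z\<close> is the imaginary part of
  \<open>(1 + t z) / (t - z) = z - (1 + z\<^sup>2) / (z - t)\<close>.\<close>

lemma cauchy_measure_eq_Re_holomorphic:
  assumes A [measurable]: "A \<in> sets borel"
  obtains h where "h holomorphic_on \<H>" "\<And>z. z \<in> \<H> \<Longrightarrow> Re (h z) = measure (cauchy_distr z) A"
proof -
  \<comment> \<open>The Cauchy law at i restricted to A. Integrating against it makes the kernel of
    the Cauchy transform integrable even when A has infinite Lebesgue measure.\<close>
  define Q where "Q = density lborel (\<lambda>t. ennreal (poisson \<i> t * indicator A t))"
  have sQ [simp, measurable_cong]: "sets Q = sets borel" by (simp add: Q_def)
  have "finite_measure Q"
  proof (rule finite_measureI)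
    have "emeasure Q (space Q) = (\<integral>\<^sup>+t. ennreal (poisson \<i> t * indicator A t) \<partial>lborel)"
      by (simp add: Q_def emeasure_density)
    also have "\<dots> \<le> (\<integral>\<^sup>+t. ennreal (poisson \<i> t) \<partial>lborel)"
      by (intro nn_integral_mono ennreal_leI) (simp add: indicator_def poisson_nonneg)
    also have "\<dots> = 1"
      by (subst nn_integral_eq_integral) (auto simp: integrable_poisson integral_poisson poisson_nonneg)
    finally show "emeasure Q (space Q) \<noteq> \<infinity>" by (auto simp: top_unique)
  qed
  then interpret Q: finite_measure Q .
  \<comment> \<open>The kernel integrated term by term, so that analyticity follows from that of the
    Cauchy transform; the factor -i turns the imaginary part into the real part.\<close>
  define h :: "complex \<Rightarrow> complex" where "h z = - \<i> * (z * measure Q UNIV - (1 + z\<^sup>2) * (\<integral>t. 1 / (z - complex_of_real t) \<partial>Q))" for z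
  have spQ: "space Q = UNIV" by (simp add: Q_def)
  show thesis
  proof (rule that)
    show "h holomorphic_on \<H>" unfolding h_def
      by (intro holomorphic_intros cauchy_transform_holomorphic Q.finite_measure_axioms sQ)
    fix z assume z: "z \<in> \<H>"
    interpret P: real_distribution "cauchy_distr z" by (rule real_distribution_cauchy) (use z in auto)
    have ik: "integrable Q (\<lambda>t. 1 / (z - complex_of_real t))"
      by (rule integrable_cauchy_kernel[OF Q.finite_measure_axioms sQ]) (use z in auto)
    have ig: "integrable Q (\<lambda>t. z - (1 + z\<^sup>2) * (1 / (z - complex_of_real t)))"
      by (intro Bochner_Integration.integrable_diff integrable_mult_right ik Q.integrable_const)
    have "z * measure Q UNIV - (1 + z\<^sup>2) * (\<integral>t. 1 / (z - complex_of_real t) \<partial>Q)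
        = (\<integral>t. z - (1 + z\<^sup>2) * (1 / (z - complex_of_real t)) \<partial>Q)"
      unfolding Bochner_Integration.integral_diff[OF Q.integrable_const integrable_mult_right[OF ik]]
        integral_mult_right_zero lebesgue_integral_const spQ
      by (simp add: scaleR_conv_of_real)
    then have "Re (h z) = (\<integral>t. Im (z - (1 + z\<^sup>2) * (1 / (z - complex_of_real t))) \<partial>Q)"
      unfolding h_def using integral_Im[OF ig] by simp
    also have "\<dots> = (\<integral>t. (poisson \<i> t * indicator A t) *\<^sub>R Im (z - (1 + z\<^sup>2) * (1 / (z - complex_of_real t))) \<partial>lborel)"
      unfolding Q_def by (rule integral_density) (auto simp: poisson_nonneg intro!: AE_I2)
    also have "\<dots> = (\<integral>t. poisson z t * indicator A t \<partial>lborel)"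
    proof (rule Bochner_Integration.integral_cong[OF refl])
      fix t
      have nz: "z - complex_of_real t \<noteq> 0" using z by (auto simp: complex_eq_iff)
      have nz2: "(t - Re z)\<^sup>2 + (Im z)\<^sup>2 > 0" using z by (auto intro!: add_nonneg_pos)
      have "z - (1 + z\<^sup>2) * (1 / (z - complex_of_real t)) = (1 + of_real t * z) * cnj (of_real t - z) / of_real ((t - Re z)\<^sup>2 + (Im z)\<^sup>2)"
      proof -
        have "of_real ((t - Re z)\<^sup>2 + (Im z)\<^sup>2) = (of_real t - z) * cnj (of_real t - z)"
          by (simp add: complex_eq_iff power2_eq_square algebra_simps)
        moreover have "cnj (of_real t - z) \<noteq> 0" using nz by (metis complex_cnj_zero_iff right_minus_eq)
        ultimately have "(1 + of_real t * z) * cnj (of_real t - z) / of_real ((t - Re z)\<^sup>2 + (Im z)\<^sup>2)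
            = (1 + of_real t * z) / (of_real t - z)" by simp
        also have "\<dots> = - (1 + of_real t * z) / (z - of_real t)"
          by (metis minus_diff_eq minus_divide_divide)
        also have "\<dots> = z - (1 + z\<^sup>2) * (1 / (z - complex_of_real t))"
          using nz by (simp add: field_simps power2_eq_square)
        finally show ?thesis by simp
      qed
      then have "Im (z - (1 + z\<^sup>2) * (1 / (z - complex_of_real t)))
          = Im ((1 + of_real t * z) * cnj (of_real t - z)) / ((t - Re z)\<^sup>2 + (Im z)\<^sup>2)"
        by (simp only: Im_divide_of_real)
      also have "Im ((1 + of_real t * z) * cnj (of_real t - z)) = Im z * (1 + t\<^sup>2)"
        by (simp add: power2_eq_square algebra_simps)
      finally have "Im (z - (1 + z\<^sup>2) * (1 / (z - complex_of_real t))) = pi * (1 + t\<^sup>2) * poisson z t"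
        unfolding poisson_def using nz2 by simp
      moreover have "poisson \<i> t * (pi * (1 + t\<^sup>2)) = 1"
        using add_pos_nonneg[OF zero_less_one zero_le_power2[of t]] unfolding poisson_def by (simp add: add.commute)
      ultimately show "(poisson \<i> t * indicator A t) *\<^sub>R Im (z - (1 + z\<^sup>2) * (1 / (z - complex_of_real t)))
          = poisson z t * indicator A t"
        by (simp add: mult_ac)
    qed
    also have "\<dots> = measure (cauchy_distr z) A"
    proof -
      have "(\<integral>t. (indicator A t :: real) \<partial>cauchy_distr z) = (\<integral>t. poisson z t *\<^sub>R indicator A t \<partial>lborel)"
        unfolding cauchy_distr_def by (rule integral_density) (use z in \<open>auto simp: poisson_nonneg intro!: AE_I2\<close>)
      then show ?thesis by simp
    qed
    finally show "Re (h z) = measure (cauchy_distr z) A" .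
  qed
qed

lemma boundary_map_affine: "y > 0 \<Longrightarrow> boundary_map (\<lambda>z. of_real x + of_real y * z) (\<lambda>t. x + y * t)"
proof
  assume y: "y > 0"
  show "AE t in lborel. ((\<lambda>s. complex_of_real x + of_real y * Complex t s) \<longlongrightarrow> complex_of_real (x + y * t)) (at_right 0)"
    unfolding Complex_eq by (auto intro!: AE_I2 tendsto_eq_intros)
qed (auto intro!: holomorphic_intros)

text \<open>The Poisson kernel at height e is symmetric in its two real arguments, so Tonelli turns
  the integral over A of the Cauchy measures of the interval into the integral over the interval of
  the Cauchy measures of A, which the hypothesis bounds. As e tends to 0 the former integrand tends
  to 1 on A inside the interval, and Fatou concludes.\<close>

lemma emeasure_Int_interval_le_if_cauchy_le:
  assumes A [measurable]: "A \<in> sets borel" and le: "\<And>z. z \<in> \<H> \<Longrightarrow> emeasure (cauchy_distr z) A \<le> c" and ab: "a \<le> b"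
  shows "emeasure lborel (A \<inter> {a<..<b}) \<le> c * ennreal (b - a)"
proof -
  let ?I = "{a<..<b}"
  define e where "e n = inverse (real (Suc n))" for n
  have e: "e n > 0" for n by (simp add: e_def)
  define f where "f n t = emeasure (cauchy_distr (Complex t (e n))) ?I * indicator A t" for n t
  have fm: "(\<lambda>(t, x). ennreal (poisson (Complex t (e n)) x) * indicator ?I x * indicator A t) \<in> borel_measurable (lborel \<Otimes>\<^sub>M lborel)" for n
    unfolding poisson_def complex.sel by measurable
  have f_eq: "f n t = (\<integral>\<^sup>+x. ennreal (poisson (Complex t (e n)) x) * indicator ?I x * indicator A t \<partial>lborel)" for n t
    unfolding f_def by (subst emeasure_cauchy_distr) (auto simp: nn_integral_multc)
  have [measurable]: "f n \<in> borel_measurable lborel" for n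
    unfolding f_eq[abs_def] using fm[of n] by (intro lborel.borel_measurable_nn_integral) simp
  have f_int: "(\<integral>\<^sup>+t. f n t \<partial>lborel) \<le> c * ennreal (b - a)" for n
  proof -
    have "(\<integral>\<^sup>+t. f n t \<partial>lborel)
        = (\<integral>\<^sup>+x. \<integral>\<^sup>+t. ennreal (poisson (Complex t (e n)) x) * indicator ?I x * indicator A t \<partial>lborel \<partial>lborel)"
      unfolding f_eq by (rule lborel_pair.Fubini'[symmetric]) (use fm in simp)
    also have "\<dots> = (\<integral>\<^sup>+x. emeasure (cauchy_distr (Complex x (e n))) A * indicator ?I x \<partial>lborel)"
    proof (rule nn_integral_cong)
      fix x
      have "poisson (Complex t (e n)) x = poisson (Complex x (e n)) t" for t
        unfolding poisson_def by (simp add: power2_commute)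
      then have "(\<integral>\<^sup>+t. ennreal (poisson (Complex t (e n)) x) * indicator ?I x * indicator A t \<partial>lborel)
          = (\<integral>\<^sup>+t. (ennreal (poisson (Complex x (e n)) t) * indicator A t) * indicator ?I x \<partial>lborel)"
        by (intro nn_integral_cong) (simp add: mult_ac)
      also have "\<dots> = emeasure (cauchy_distr (Complex x (e n))) A * indicator ?I x"
        by (subst nn_integral_multc) (auto simp: emeasure_cauchy_distr)
      finally show "(\<integral>\<^sup>+t. ennreal (poisson (Complex t (e n)) x) * indicator ?I x * indicator A t \<partial>lborel)
          = emeasure (cauchy_distr (Complex x (e n))) A * indicator ?I x" .
    qed
    also have "\<dots> \<le> (\<integral>\<^sup>+x. c * indicator ?I x \<partial>lborel)"
      using le e by (intro nn_integral_mono mult_right_mono) auto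
    also have "\<dots> = c * ennreal (b - a)" using ab by (simp add: nn_integral_cmult)
    finally show ?thesis .
  qed
  have lim: "(\<lambda>n. emeasure (cauchy_distr (Complex t (e n))) ?I) \<longlonglongrightarrow> 1" if t: "t \<in> ?I" for t
  proof -
    interpret P: real_distribution "cauchy_distr \<i>" by (rule real_distribution_cauchy) simp
    \<comment> \<open>The affine map sends the Cauchy law at i to the one at t + i e, so shrinking e
      amounts to widening the set under a fixed law.\<close>
    define S where "S n = (\<lambda>s. t + e n * s) -` ?I" for n
    have eq: "emeasure (cauchy_distr (Complex t (e n))) ?I = emeasure (cauchy_distr \<i>) (S n)" for n
    proof -
      interpret boundary_map "\<lambda>z. of_real t + of_real (e n) * z" "\<lambda>s. t + e n * s"
        using e by (rule boundary_map_affine)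
      show ?thesis using emeasure_vimage_cauchy[of \<i> ?I] by (simp add: S_def Complex_eq mult.commute)
    qed
    have S_eq: "S n = {real (Suc n) * (a - t)<..<real (Suc n) * (b - t)}" for n
      unfolding S_def e_def by (auto simp: field_simps simp del: of_nat_Suc)
    have "incseq S"
    proof (rule incseq_SucI)
      fix n
      have "real (Suc (Suc n)) * (a - t) \<le> real (Suc n) * (a - t)" using t by (intro mult_right_mono_neg) auto
      moreover have "real (Suc n) * (b - t) \<le> real (Suc (Suc n)) * (b - t)" using t by (intro mult_right_mono) auto
      ultimately show "S n \<subseteq> S (Suc n)" unfolding S_eq by auto
    qed
    moreover have "(\<Union>n. S n) = UNIV"
    proof (rule UNIV_eq_I[symmetric])
      fix s :: real
      have "e \<longlonglongrightarrow> 0" unfolding e_def by (rule LIMSEQ_inverse_real_of_nat)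
      then have "(\<lambda>n. t + e n * s) \<longlonglongrightarrow> t + 0 * s" by (intro tendsto_intros)
      then have "eventually (\<lambda>n. t + e n * s \<in> ?I) sequentially"
        using t by (intro topological_tendstoD) auto
      then obtain n where "t + e n * s \<in> ?I" by (auto simp: eventually_sequentially)
      then show "s \<in> (\<Union>n. S n)" unfolding S_def by blast
    qed
    ultimately show ?thesis
      unfolding eq using Lim_emeasure_incseq[of S "cauchy_distr \<i>"] P.emeasure_space_1 by (simp add: S_eq image_subset_iff)
  qed
  have "emeasure lborel (A \<inter> ?I) = (\<integral>\<^sup>+t. indicator (A \<inter> ?I) t \<partial>lborel)" by simp
  also have "\<dots> \<le> (\<integral>\<^sup>+t. liminf (\<lambda>n. f n t) \<partial>lborel)"
  proof (rule nn_integral_mono)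
    fix t
    show "indicator (A \<inter> ?I) t \<le> liminf (\<lambda>n. f n t)"
    proof (cases "t \<in> A \<inter> ?I")
      case True
      then have "(\<lambda>n. f n t) \<longlonglongrightarrow> 1" using lim unfolding f_def by simp
      then show ?thesis using True by (simp add: lim_imp_Liminf)
    qed simp
  qed
  also have "\<dots> \<le> liminf (\<lambda>n. \<integral>\<^sup>+t. f n t \<partial>lborel)" by (rule nn_integral_liminf) measurable
  also have "\<dots> \<le> limsup (\<lambda>n. \<integral>\<^sup>+t. f n t \<partial>lborel)" by (rule Liminf_le_Limsup) simp
  also have "\<dots> \<le> c * ennreal (b - a)" by (rule Limsup_bounded) (use f_int in simp)
  finally show ?thesis .
qed

text \<open>The previous bound for A with c and for its complement with 1 - c must be sharp, as the
  two bounds add up to the length of the interval. So A fills the same proportion c of every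
  interval.\<close>

lemma null_or_conull_if_cauchy_measure_const:
  assumes A [measurable]: "A \<in> sets borel" and const: "\<And>z. z \<in> \<H> \<Longrightarrow> measure (cauchy_distr z) A = c"
  shows "emeasure lborel A = 0 \<or> emeasure lborel (- A) = 0"
proof -
  have P: "real_distribution (cauchy_distr z)" if "z \<in> \<H>" for z using that real_distribution_cauchy by auto
  interpret Pi: real_distribution "cauchy_distr \<i>" by (rule P) simp
  have c: "0 \<le> c" "c \<le> 1" using const[of \<i>] Pi.prob_le_1[of A] measure_nonneg[of "cauchy_distr \<i>" A] by auto
  have eA: "emeasure (cauchy_distr z) A \<le> ennreal c" if "z \<in> \<H>" for z
  proof -
    interpret real_distribution "cauchy_distr z" using P that .
    show ?thesis using const[OF that] by (simp add: emeasure_eq_measure)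
  qed
  have eB: "emeasure (cauchy_distr z) (- A) \<le> ennreal (1 - c)" if "z \<in> \<H>" for z
  proof -
    interpret real_distribution "cauchy_distr z" using P that .
    show ?thesis using const[OF that] prob_compl[of A] by (simp add: emeasure_eq_measure Compl_eq_Diff_UNIV)
  qed
  have eq: "emeasure lborel (A \<inter> {a<..<b}) = ennreal (c * (b - a))" if ab: "a \<le> b" for a b
  proof -
    have f: "A \<inter> {a<..<b} \<in> fmeasurable lborel" "- A \<inter> {a<..<b} \<in> fmeasurable lborel"
      using fmeasurable_Int_fmeasurable[of "{a<..<b}" lborel A] fmeasurable_Int_fmeasurable[of "{a<..<b}" lborel "-A"]
      by (auto simp: Int_commute fmeasurable_def ab)
    have 1: "measure lborel (A \<inter> {a<..<b}) \<le> c * (b - a)"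
      using emeasure_Int_interval_le_if_cauchy_le[OF A eA ab] f(1) c ab
      by (simp add: emeasure_eq_measure2 flip: ennreal_mult)
    have 2: "measure lborel (- A \<inter> {a<..<b}) \<le> (1 - c) * (b - a)"
      using emeasure_Int_interval_le_if_cauchy_le[OF _ eB ab] f(2) c ab
      by (simp add: emeasure_eq_measure2 flip: ennreal_mult)
    have "measure lborel {a<..<b} = measure lborel ((A \<inter> {a<..<b}) \<union> (- A \<inter> {a<..<b}))"
      by (rule arg_cong[where f = "measure lborel"]) auto
    also have "\<dots> = measure lborel (A \<inter> {a<..<b}) + measure lborel (- A \<inter> {a<..<b})"
      by (rule measure_Un_AE) (use f in \<open>auto intro!: AE_I2\<close>)
    finally have "measure lborel (A \<inter> {a<..<b}) = c * (b - a)" using 1 2 ab by (simp add: algebra_simps)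
    then show ?thesis using f(1) by (simp add: emeasure_eq_measure2)
  qed
  show ?thesis
  proof (cases "c = 0")
    case True
    have "emeasure lborel (\<Union>n. A \<inter> {- real n<..<real n}) = 0"
      by (rule emeasure_UN_eq_0) (use eq True in auto)
    moreover have "A = (\<Union>n. A \<inter> {- real n<..<real n})"
    proof safe
      fix t assume "t \<in> A"
      obtain n where "\<bar>t\<bar> < real n" using reals_Archimedean2 by blast
      then show "t \<in> (\<Union>n. A \<inter> {- real n<..<real n})" using \<open>t \<in> A\<close> by (auto simp: abs_less_iff intro!: exI[of _ n])
    qed
    ultimately show ?thesis by simp
  next
    case False
    then have c0: "c > 0" using c by simp
    \<comment> \<open>Lebesgue measure is determined by its values on intervals, hence is
      concentrated on A. This takes the place of a density-point argument.\<close>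
    have "lborel = density lborel (\<lambda>t. ennreal (1 / c) * indicator A t)"
    proof (rule lborel_eqI)
      fix l u :: real assume "\<And>b. b \<in> Basis \<Longrightarrow> l \<bullet> b \<le> u \<bullet> b"
      then have lu: "l \<le> u" by simp
      have "emeasure (density lborel (\<lambda>t. ennreal (1 / c) * indicator A t)) {l<..<u}
          = (\<integral>\<^sup>+t. ennreal (1 / c) * indicator (A \<inter> {l<..<u}) t \<partial>lborel)"
        by (subst emeasure_density) (auto intro!: nn_integral_cong simp: indicator_def)
      also have "\<dots> = ennreal (1 / c) * ennreal (c * (u - l))"
        using eq[OF lu] by (simp add: nn_integral_cmult)
      also have "\<dots> = ennreal (u - l)" using c0 lu by (simp flip: ennreal_mult')
      finally show "emeasure (density lborel (\<lambda>t. ennreal (1 / c) * indicator A t)) (box l u) = ennreal (\<Prod>b\<in>Basis. (u - l) \<bullet> b)"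
        by (simp add: box_real)
    qed simp
    then have "emeasure lborel (- A) = emeasure (density lborel (\<lambda>t. ennreal (1 / c) * indicator A t)) (- A)"
      by simp
    also have "\<dots> = (\<integral>\<^sup>+t. 0 \<partial>lborel)"
    proof -
      have "ennreal (1 / c) * indicator A t * indicator (- A) t = 0" for t by (simp add: indicator_def)
      then show ?thesis by (subst emeasure_density) (auto intro!: nn_integral_cong simp del: mult_eq_0_iff)
    qed
    finally show ?thesis by simp
  qed
qed

text \<open>The imaginary axis contains no disc, so the open mapping theorem excludes a nonconstant
  k.\<close>

lemma holomorphic_uhp_const_if_Re_eq_0:
  assumes hol: "k holomorphic_on \<H>" and Re: "\<And>z. z \<in> \<H> \<Longrightarrow> Re (k z) = 0"
  obtains c where "\<And>z. z \<in> \<H> \<Longrightarrow> k z = \<i> * complex_of_real c"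
proof -
  have "k constant_on \<H>"
  proof (rule ccontr)
    assume "\<not> k constant_on \<H>"
    then have "open (k ` \<H>)"
      using open_mapping_thm[OF hol open_uhp convex_connected[OF convex_uhp] open_uhp] by blast
    moreover have i: "\<i> \<in> \<H>" by simp
    ultimately obtain d where d: "d > 0" "ball (k \<i>) d \<subseteq> k ` \<H>"
      using open_contains_ball by blast
    have "k \<i> + of_real (d / 2) \<in> ball (k \<i>) d" using d(1) by (simp add: dist_norm)
    then obtain w where "w \<in> \<H>" "k \<i> + of_real (d / 2) = k w" using d(2) by blast
    then show False using Re[OF i] Re[of w] d(1) by (auto simp: complex_eq_iff)
  qed
  then obtain x where x: "\<And>z. z \<in> \<H> \<Longrightarrow> k z = x" by (auto simp: constant_on_def)
  have "Re x = 0" using Re[of \<i>] x[of \<i>] by simp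
  then have "x = \<i> * complex_of_real (Im x)" by (simp add: complex_eq_iff)
  then show thesis using that[of "Im x"] x by simp
qed

context boundary_map
begin

text \<open>If \<open>A\<close> is invariant then \<open>z \<mapsto> P\<^sub>z(A)\<close> is \<open>F\<close>-invariant, and its analytic completion is so up
  to an imaginary constant; a suitable exponential of it is bounded, analytic and takes the same
  value along the whole orbit of \<open>i\<close>, which violates the Blaschke condition unless it is constant.\<close>

lemma ergodic_if_orbit_not_summable:
  assumes Im_F: "\<And>z. z \<in> \<H> \<Longrightarrow> Im (F z) > Im z"
    and div: "\<not> summable (\<lambda>n. Im ((F ^^ n) \<i>) / (norm ((F ^^ n) \<i>))\<^sup>2)"
  shows "ergodic lborel T"
  unfolding ergodic_def
proof (intro ballI impI)
  fix A :: "real set" assume "A \<in> sets lborel" and inv: "T -` A \<inter> space lborel = A"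
  then have A [measurable]: "A \<in> sets borel" by simp
  define z where "z n = (F ^^ n) \<i>" for n
  have zH: "z n \<in> \<H>" for n unfolding z_def by (rule funpow_uhp) simp
  \<comment> \<open>Strictly increasing heights make the orbit points distinct, so that they count
    as infinitely many zeros.\<close>
  have sm: "strict_mono (\<lambda>n. Im (z n))"
    using Im_F zH by (intro strict_mono_Suc_iff[THEN iffD2]) (simp add: z_def)
  have inj: "inj z"
  proof (rule injI)
    fix m n assume "z m = z n"
    then show "m = n" using strict_mono_eq[OF sm, of m n] by simp
  qed
  have mono: "mono (\<lambda>n. Im (z n))" using sm by (rule strict_mono_mono)
  have norm_z: "norm (z n) \<ge> 1" for n
    using monoD[OF mono, of 0 n] abs_Im_le_cmod[of "z n"] by (simp add: z_def)
  obtain h where h: "h holomorphic_on \<H>" "\<And>z. z \<in> \<H> \<Longrightarrow> Re (h z) = measure (cauchy_distr z) A"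
    using cauchy_measure_eq_Re_holomorphic[OF A] by blast
  have u_F: "measure (cauchy_distr (F w)) A = measure (cauchy_distr w) A" if "w \<in> \<H>" for w
    using emeasure_vimage_cauchy[OF that A] inv by (simp add: measure_def)
  have hF: "(\<lambda>w. h (F w)) holomorphic_on \<H>"
    using holomorphic_on_compose_gen[OF hol h(1)] map by (auto simp: comp_def)
  obtain c where c: "\<And>w. w \<in> \<H> \<Longrightarrow> h (F w) - h w = \<i> * complex_of_real c"
    by (rule holomorphic_uhp_const_if_Re_eq_0[of "\<lambda>w. h (F w) - h w"])
      (use hF h u_F map in \<open>auto intro!: holomorphic_intros\<close>)
  \<comment> \<open>Chosen so that exp (i \<kappa> c) = 1, which removes the additive constant. It
    is real, so |g| depends only on the Cauchy measure of A, and nonzero, so this measure can be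
    recovered from |g|.\<close>
  define \<kappa> where "\<kappa> = (if c = 0 then 1 else 2 * pi / c)"
  have \<kappa>: "\<kappa> \<noteq> 0" by (simp add: \<kappa>_def)
  define g where "g w = exp (of_real \<kappa> * h w)" for w
  have g_hol: "g holomorphic_on \<H>" unfolding g_def by (intro holomorphic_intros h)
  have g_F: "g (F w) = g w" if "w \<in> \<H>" for w
  proof -
    have "h (F w) = h w + \<i> * of_real c" using c[OF that] by (simp add: algebra_simps)
    then have "g (F w) = g w * exp (of_real \<kappa> * (\<i> * of_real c))" by (simp add: g_def distrib_left exp_add)
    moreover have "exp (of_real \<kappa> * (\<i> * of_real c)) = 1"
      by (cases "c = 0") (auto simp: \<kappa>_def mult_ac)
    ultimately show ?thesis by simp
  qed
  have g_z: "g (z n) = g \<i>" for n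
    by (induction n) (use g_F zH in \<open>auto simp: z_def\<close>)
  have norm_g: "norm (g w) = exp (\<kappa> * measure (cauchy_distr w) A)" if "w \<in> \<H>" for w
    using h(2)[OF that] by (simp add: g_def norm_exp)
  have bd: "norm (g w) \<le> exp \<bar>\<kappa>\<bar>" if w: "w \<in> \<H>" for w
  proof -
    interpret real_distribution "cauchy_distr w" by (rule real_distribution_cauchy) (use w in auto)
    have "\<kappa> * measure (cauchy_distr w) A \<le> \<bar>\<kappa>\<bar> * 1" by (intro mult_mono) auto
    then show ?thesis using norm_g[OF w] by simp
  qed
  have g_const: "g w - g \<i> = 0" if w: "w \<in> \<H>" for w
  proof (rule holomorphic_uhp_eq_0_if_not_blaschke[OF _ _ inj zH norm_z _ _ w])
    show "(\<lambda>w. g w - g \<i>) holomorphic_on \<H>" by (intro holomorphic_intros g_hol)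
    show "norm (g v - g \<i>) \<le> 2 * exp \<bar>\<kappa>\<bar>" if "v \<in> \<H>" for v
      using norm_triangle_ineq4[of "g v" "g \<i>"] bd[OF that] bd[of \<i>] by simp
  qed (use g_z div in \<open>auto simp: z_def\<close>)
  have "measure (cauchy_distr w) A = measure (cauchy_distr \<i>) A" if "w \<in> \<H>" for w
    using g_const[OF that] norm_g[OF that] norm_g[of \<i>] \<kappa> by auto
  then have "emeasure lborel A = 0 \<or> emeasure lborel (- A) = 0"
    by (rule null_or_conull_if_cauchy_measure_const[OF A])
  then show "emeasure lborel A = 0 \<or> emeasure lborel (space lborel - A) = 0"
    by (simp add: Compl_eq_Diff_UNIV)
qed

end

section \<open>Characteristic functions under the central limit theorem\<close>

lemma real_distribution_convolution:
  assumes "real_distribution M" "real_distribution N"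
  shows "real_distribution (convolution M N)"
proof -
  interpret M: real_distribution M by fact
  interpret N: real_distribution N by fact
  interpret pair_prob_space M N ..
  show ?thesis unfolding convolution_def by (rule real_distribution_distr) simp
qed

lemma char_convolution:
  assumes "real_distribution M" "real_distribution N"
  shows "char (convolution M N) s = char M s * char N s"
proof -
  interpret M: real_distribution M by fact
  interpret N: real_distribution N by fact
  interpret MN: pair_prob_space M N ..
  have [measurable]: "(\<lambda>(x, y). iexp (s * (x + y))) \<in> borel_measurable (M \<Otimes>\<^sub>M N)" by measurable
  have int: "integrable (M \<Otimes>\<^sub>M N) (\<lambda>(x, y). iexp (s * (x + y)))"
    by (rule MN.P.integrable_const_bound[where B = 1]) (auto simp: norm_exp_i_times simp del: of_real_mult of_real_add)
  have "char (convolution M N) s = (\<integral>p. iexp (s * (case p of (x, y) \<Rightarrow> x + y)) \<partial>(M \<Otimes>\<^sub>M N))"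
    unfolding char_def convolution_def by (rule integral_distr) measurable
  also have "\<dots> = (\<integral>(x, y). iexp (s * (x + y)) \<partial>(M \<Otimes>\<^sub>M N))"
    by (intro Bochner_Integration.integral_cong) auto
  also have "\<dots> = (\<integral>x. \<integral>y. iexp (s * (x + y)) \<partial>N \<partial>M)"
    using MN.integral_fst[OF int] by simp
  also have "\<dots> = (\<integral>x. iexp (s * x) * char N s \<partial>M)"
    unfolding char_def by (simp add: distrib_left exp_add)
  finally show ?thesis unfolding char_def by simp
qed

lemma real_distribution_conv_power:
  "real_distribution \<mu> \<Longrightarrow> real_distribution (conv_power \<mu> n)"
proof (induction n)
  case 0
  have "prob_space (return borel (0::real))" by (rule prob_space_return) simp
  then show ?case by (simp add: real_distribution_def real_distribution_axioms_def)
qed (simp add: real_distribution_convolution)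

lemma char_conv_power: "real_distribution \<mu> \<Longrightarrow> char (conv_power \<mu> n) s = char \<mu> s ^ n"
proof (induction n)
  case 0
  show ?case by (simp add: char_def integral_return)
qed (simp add: char_convolution real_distribution_conv_power)

lemma real_distribution_dilation: "real_distribution \<mu> \<Longrightarrow> real_distribution (dilation b \<mu>)"
proof -
  assume "real_distribution \<mu>"
  then interpret real_distribution \<mu> .
  show ?thesis unfolding dilation_def by (rule real_distribution_distr) measurable
qed

lemma char_dilation:
  assumes "real_distribution \<mu>"
  shows "char (dilation b \<mu>) s = char \<mu> (b * s)"
proof -
  interpret real_distribution \<mu> by fact
  show ?thesis unfolding char_def dilation_def by (subst integral_distr) (auto simp: mult_ac)
qed

text \<open>For a point mass all the characteristic functions involved have modulus 1, whereas the
  normal limit has modulus exp (-1/2) at 1. Nondegeneracy is what makes \<open>F\<close> raise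
  heights strictly.\<close>

lemma clt_norming_not_dirac:
  assumes "real_distribution \<mu>" "clt_norming \<mu> B"
  shows "\<not> (AE t in \<mu>. t = a)"
proof
  interpret real_distribution \<mu> by fact
  assume ae: "AE t in \<mu>. t = a"
  have "norm (char \<mu> s) = 1" for s
  proof -
    have "char \<mu> s = (\<integral>t. iexp (s * a) \<partial>\<mu>)"
      unfolding char_def by (rule integral_cong_AE) (use ae in auto)
    also have "\<dots> = iexp (s * a)" by (simp add: prob_space[simplified])
    finally show ?thesis by (simp only: norm_exp_i_times)
  qed
  then have "norm (char (dilation (1 / B n) (conv_power \<mu> n)) 1) = 1" for n
    using assms(1) by (simp add: char_dilation char_conv_power real_distribution_conv_power norm_power)
  moreover have "(\<lambda>n. norm (char (dilation (1 / B n) (conv_power \<mu> n)) 1)) \<longlonglongrightarrow> norm (char std_normal_distribution 1)"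
    using assms unfolding clt_norming_def
    by (intro tendsto_norm levy_continuity1 real_distribution_dilation real_distribution_conv_power real_dist_normal_dist) auto
  ultimately have "(\<lambda>n::nat. 1::real) \<longlonglongrightarrow> norm (char std_normal_distribution 1)" by simp
  then have "norm (char std_normal_distribution 1) = 1" using LIMSEQ_unique[OF _ tendsto_const] by blast
  then show False by (simp add: char_std_normal_distribution)
qed

text \<open>As a polynomial in h the left-hand side has nonnegative coefficients, so it is largest
  at |h|.\<close>

lemma norm_power_one_plus_diff_le:
  fixes h :: complex
  shows "norm ((1 + h) ^ n - 1 - of_nat n * h) \<le> (1 + norm h) ^ n - 1 - real n * norm h"
proof (induction n)
  case (Suc n)
  have "(1 + h) ^ Suc n - 1 - of_nat (Suc n) * h = (1 + h) * ((1 + h) ^ n - 1 - of_nat n * h) + of_nat n * h * h"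
    by (simp add: algebra_simps)
  then have "norm ((1 + h) ^ Suc n - 1 - of_nat (Suc n) * h)
      \<le> norm (1 + h) * norm ((1 + h) ^ n - 1 - of_nat n * h) + real n * norm h * norm h"
    using norm_triangle_ineq[of "(1 + h) * ((1 + h) ^ n - 1 - of_nat n * h)" "of_nat n * h * h"]
    by (simp add: norm_mult)
  also have "\<dots> \<le> (1 + norm h) * ((1 + norm h) ^ n - 1 - real n * norm h) + real n * norm h * norm h"
    using norm_triangle_ineq[of 1 h] by (intro add_right_mono mult_mono Suc.IH) auto
  also have "\<dots> = (1 + norm h) ^ Suc n - 1 - real (Suc n) * norm h"
    by (simp add: algebra_simps)
  finally show ?case .
qed simp

text \<open>With a = n |w - 1| the linear term of w^n - 1 has modulus a and the remainder is at most
  a^2, hence at most a / 2.\<close>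

lemma norm_diff_one_le_norm_power_diff_one:
  fixes w :: complex
  assumes "real n * norm (w - 1) \<le> 1 / 2"
  shows "real n * norm (w - 1) \<le> 2 * norm (w ^ n - 1)"
proof -
  define a where "a = real n * norm (w - 1)"
  have a: "0 \<le> a" "a \<le> 1 / 2" using assms by (auto simp: a_def)
  have "norm (w ^ n - 1 - of_nat n * (w - 1)) \<le> (1 + norm (w - 1)) ^ n - 1 - a"
    using norm_power_one_plus_diff_le[of "w - 1" n] by (simp add: a_def)
  also have "(1 + norm (w - 1)) ^ n \<le> exp (norm (w - 1)) ^ n"
    by (intro power_mono exp_ge_add_one_self) auto
  also have "\<dots> = exp a" by (simp add: a_def exp_of_nat_mult)
  also have "exp a \<le> 1 + a + a\<^sup>2" using a by (intro exp_bound) auto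
  finally have "norm (w ^ n - 1 - of_nat n * (w - 1)) \<le> a\<^sup>2" by simp
  moreover have "a = norm (of_nat n * (w - 1))" by (simp add: a_def norm_mult)
  moreover have "norm (of_nat n * (w - 1)) \<le> norm (w ^ n - 1) + norm (w ^ n - 1 - of_nat n * (w - 1))"
    by (rule order_trans[OF _ norm_triangle_ineq4]) simp
  moreover have "a\<^sup>2 \<le> a / 2" using mult_left_mono[OF a(2) a(1)] by (simp add: power2_eq_square)
  ultimately show ?thesis unfolding a_def[symmetric] by linarith
qed

text \<open>The exponent \<open>n\<close> is removed by continuity in \<open>s\<close>: by the previous lemma
  \<open>n |\<phi>(s / B\<^sub>n) - 1|\<close> cannot lie strictly between a small number and \<open>1/2\<close>.\<close>

lemma clt_norming_char_small:
  assumes \<mu>: "real_distribution \<mu>" and clt: "clt_norming \<mu> B" and \<epsilon>: "\<epsilon> > 0"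
  obtains \<delta> n0 where "\<delta> > 0" "n0 \<ge> 1"
    "\<And>n s. \<lbrakk>n \<ge> n0; 0 \<le> s; s \<le> \<delta>\<rbrakk> \<Longrightarrow> real n * norm (char \<mu> (s / B n) - 1) \<le> \<epsilon>"
proof -
  interpret \<mu>: real_distribution \<mu> by fact
  define \<nu> where "\<nu> n = dilation (1 / B n) (conv_power \<mu> n)" for n
  have \<nu>: "real_distribution (\<nu> n)" for n
    unfolding \<nu>_def by (intro real_distribution_dilation real_distribution_conv_power \<mu>)
  have char_\<nu>: "char (\<nu> n) s = char \<mu> (s / B n) ^ n" for n s
    unfolding \<nu>_def by (simp add: char_dilation char_conv_power real_distribution_conv_power \<mu>)
  define N where "N = std_normal_distribution"
  have N: "real_distribution N" unfolding N_def by (rule real_dist_normal_dist)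
  interpret N: real_distribution N by fact
  \<comment> \<open>The bound 1/8 gives 2 \<eta> \<le> 1/4 and thus leaves a gap below the forbidden
    value 1/2.\<close>
  define \<eta> where "\<eta> = min (\<epsilon> / 2) (1 / 8)"
  have \<eta>: "\<eta> > 0" "2 * \<eta> \<le> \<epsilon>" "2 * \<eta> < 1 / 2" using \<epsilon> by (auto simp: \<eta>_def min_def)
  \<comment> \<open>Dominates |exp (i s x) - 1| for all s in [0, \<delta>] at once and is bounded
    and continuous, so a single use of weak convergence gives an estimate uniform in s.\<close>
  define f where "f \<delta> x = min 2 (\<delta> * \<bar>x\<bar>)" for \<delta> x :: real
  have f_m [measurable]: "f \<delta> \<in> borel_measurable borel" for \<delta> unfolding f_def by measurable
  have f_bd: "\<bar>f \<delta> x\<bar> \<le> 2" if "\<delta> \<ge> 0" for \<delta> x using that by (auto simp: f_def min_def)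
  have "(\<lambda>m. \<integral>x. f (inverse (real (Suc m))) x \<partial>N) \<longlonglongrightarrow> (\<integral>x. 0 \<partial>N)"
  proof (rule integral_dominated_convergence[where w = "\<lambda>_. 2"])
    show "AE x in N. (\<lambda>m. f (inverse (real (Suc m))) x) \<longlonglongrightarrow> 0"
    proof (rule AE_I2)
      fix x
      have "(\<lambda>m. min 2 (inverse (real (Suc m)) * \<bar>x\<bar>)) \<longlonglongrightarrow> min 2 (0 * \<bar>x\<bar>)"
        by (intro tendsto_intros LIMSEQ_inverse_real_of_nat)
      then show "(\<lambda>m. f (inverse (real (Suc m))) x) \<longlonglongrightarrow> 0" by (simp add: f_def)
    qed
  qed (use f_bd in auto)
  then have "eventually (\<lambda>m. (\<integral>x. f (inverse (real (Suc m))) x \<partial>N) < \<eta>) sequentially"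
    using \<eta>(1) by (intro order_tendstoD) auto
  then obtain m where m: "(\<integral>x. f (inverse (real (Suc m))) x \<partial>N) < \<eta>"
    by (auto simp: eventually_sequentially)
  define \<delta> where "\<delta> = inverse (real (Suc m))"
  have \<delta>: "\<delta> > 0" by (simp add: \<delta>_def)
  have "(\<lambda>n. \<integral>x. f \<delta> x \<partial>\<nu> n) \<longlonglongrightarrow> (\<integral>x. f \<delta> x \<partial>N)"
  proof (rule weak_conv_imp_integral_bdd_continuous_conv[OF \<nu> N])
    show "weak_conv_m \<nu> N" using clt by (simp add: clt_norming_def \<nu>_def[abs_def] N_def)
    show "isCont (f \<delta>) x" for x unfolding f_def by (intro continuous_intros)
    show "norm (f \<delta> x) \<le> 2" for x using f_bd \<delta> by simp
  qed
  then have "eventually (\<lambda>n. (\<integral>x. f \<delta> x \<partial>\<nu> n) < \<eta>) sequentially"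
    using m by (intro order_tendstoD) (auto simp: \<delta>_def)
  then obtain n0 where n0: "\<And>n. n \<ge> n0 \<Longrightarrow> (\<integral>x. f \<delta> x \<partial>\<nu> n) < \<eta>"
    by (auto simp: eventually_sequentially)
  have small: "norm (char \<mu> (s / B n) ^ n - 1) < \<eta>" if "n \<ge> n0" "0 \<le> s" "s \<le> \<delta>" for n s
  proof -
    interpret \<nu>: real_distribution "\<nu> n" by (rule \<nu>)
    have i: "integrable (\<nu> n) (\<lambda>x. iexp (s * x))" by (rule \<nu>.integrable_iexp) auto
    have "char (\<nu> n) s - 1 = (\<integral>x. iexp (s * x) - 1 \<partial>\<nu> n)"
      unfolding char_def using i by (simp add: \<nu>.prob_space[simplified])
    also have "norm \<dots> \<le> (\<integral>x. norm (iexp (s * x) - 1) \<partial>\<nu> n)" by (rule integral_norm_bound)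
    also have "\<dots> \<le> (\<integral>x. f \<delta> x \<partial>\<nu> n)"
    proof (rule integral_mono)
      show "integrable (\<nu> n) (\<lambda>x. norm (iexp (s * x) - 1))" using i by auto
      show "integrable (\<nu> n) (f \<delta>)"
        using f_bd[of \<delta>] \<delta> by (intro \<nu>.integrable_const_bound[where B = 2]) auto
      fix x
      have "norm (iexp (s * x) - 1) \<le> \<bar>s * x\<bar>" using iexp_approx1[of "s * x" 0] by simp
      also have "\<dots> \<le> \<delta> * \<bar>x\<bar>" using that by (simp add: abs_mult mult_right_mono)
      finally have "norm (iexp (s * x) - 1) \<le> \<delta> * \<bar>x\<bar>" .
      moreover have "norm (iexp (s * x) - 1) \<le> 2"
        by (rule order_trans[OF norm_triangle_ineq4]) (simp add: norm_exp_i_times del: of_real_mult)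
      ultimately show "norm (iexp (s * x) - 1) \<le> f \<delta> x" by (simp add: f_def)
    qed
    also have "\<dots> < \<eta>" using n0 that by simp
    finally show ?thesis unfolding char_\<nu> .
  qed
  have "real n * norm (char \<mu> (s / B n) - 1) \<le> \<epsilon>" if n: "n \<ge> max n0 1" and s: "0 \<le> s" "s \<le> \<delta>" for n s
  proof -
    define a where "a s = real n * norm (char \<mu> (s / B n) - 1)" for s
    have B: "B n > 0" using clt n by (simp add: clt_norming_def)
    have cont: "continuous_on {0..s} a"
    proof -
      have "isCont (\<lambda>s. char \<mu> (s / B n)) x" for x
        by (rule isCont_o2[OF _ \<mu>.isCont_char]) (use B in \<open>auto intro!: continuous_intros\<close>)
      then have "isCont a x" for x unfolding a_def by (intro continuous_intros)
      then show ?thesis by (simp add: continuous_at_imp_continuous_on)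
    qed
    have gap: "a r \<le> 2 * \<eta>" if "0 \<le> r" "r \<le> s" "a r \<le> 1 / 2" for r
      using norm_diff_one_le_norm_power_diff_one[of n "char \<mu> (r / B n)"] small[of n r] that s n
      unfolding a_def by simp
    have "a s \<le> 1 / 2"
    proof (rule ccontr)
      assume "\<not> a s \<le> 1 / 2"
      moreover have "a 0 = 0" by (simp add: a_def \<mu>.char_zero)
      ultimately obtain r where "0 \<le> r" "r \<le> s" "a r = 1 / 2"
        using IVT'[of a 0 "1 / 2" s, OF _ _ s(1) cont] by auto
      then show False using gap[of r] \<eta>(3) by simp
    qed
    then show ?thesis using gap[of s] s(1) \<eta>(2) unfolding a_def by simp
  qed
  then show thesis using that[of \<delta> "max n0 1"] \<delta> by simp
qed

text \<open>With d = exp (i u x) - 1 one has exp (2 i u x) - 1 = 2 d + d^2, and |d|^2 = 2 Re (1 -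
  exp (i u x)); each of the two terms contributes at most 2 |1 - \<phi>(u)|.\<close>

lemma (in real_distribution) norm_one_minus_char_double:
  "norm (1 - char M (2 * u)) \<le> 4 * norm (1 - char M u)"
proof -
  have i: "integrable M (\<lambda>x. iexp (u * x))" for u by (rule integrable_iexp) auto
  define d where "d x = iexp (u * x) - 1" for x
  have sq: "(norm (d x))\<^sup>2 = 2 * Re (1 - iexp (u * x))" for x
  proof -
    have "(norm (d x))\<^sup>2 = (cos (u * x) - 1)\<^sup>2 + (sin (u * x))\<^sup>2"
      unfolding d_def cmod_power2 by (simp add: Re_exp Im_exp)
    also have "\<dots> = 2 - 2 * cos (u * x)"
      using sin_cos_squared_add[of "u * x"] by (simp add: power2_eq_square algebra_simps)
    finally show ?thesis by (simp add: Re_exp)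
  qed
  have id: "integrable M d" unfolding d_def using i by simp
  have isq: "integrable M (\<lambda>x. (norm (d x))\<^sup>2)" unfolding sq using i by auto
  have eq: "iexp (2 * u * x) - 1 = 2 * d x + (d x)\<^sup>2" for x
  proof -
    have "iexp (2 * u * x) = (iexp (u * x))\<^sup>2" unfolding power2_eq_square exp_add[symmetric] by (simp add: algebra_simps)
    then show ?thesis unfolding d_def by (simp add: power2_eq_square algebra_simps)
  qed
  have id2: "integrable M (\<lambda>x. (d x)\<^sup>2)"
    by (rule Bochner_Integration.integrable_bound[OF isq]) (auto simp: norm_power d_def)
  have "char M (2 * u) - 1 = (\<integral>x. iexp (2 * u * x) - 1 \<partial>M)"
    unfolding char_def using i[of "2 * u"] by (simp add: prob_space[simplified])
  also have "\<dots> = 2 * (\<integral>x. d x \<partial>M) + (\<integral>x. (d x)\<^sup>2 \<partial>M)"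
    unfolding eq using id id2 by simp
  also have "(\<integral>x. d x \<partial>M) = char M u - 1"
    unfolding char_def d_def using i by (simp add: prob_space[simplified])
  finally have e: "char M (2 * u) - 1 = 2 * (char M u - 1) + (\<integral>x. (d x)\<^sup>2 \<partial>M)" .
  have "norm (char M (2 * u) - 1) \<le> 2 * norm (char M u - 1) + norm (\<integral>x. (d x)\<^sup>2 \<partial>M)"
    unfolding e by (rule order_trans[OF norm_triangle_ineq]) (simp only: norm_mult norm_numeral order_refl)
  moreover have "norm (\<integral>x. (d x)\<^sup>2 \<partial>M) \<le> (\<integral>x. (norm (d x))\<^sup>2 \<partial>M)"
    using integral_norm_bound[of M "\<lambda>x. (d x)\<^sup>2"] by (simp add: norm_power)
  moreover have "(\<integral>x. (norm (d x))\<^sup>2 \<partial>M) = 2 * Re (1 - char M u)"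
  proof -
    have "integrable M (\<lambda>x. 1 - iexp (u * x))" using i[of u] by simp
    then have "(\<integral>x. Re (1 - iexp (u * x)) \<partial>M) = Re (\<integral>x. 1 - iexp (u * x) \<partial>M)" by (rule integral_Re)
    also have "(\<integral>x. 1 - iexp (u * x) \<partial>M) = 1 - char M u"
      unfolding char_def using i[of u] by (simp add: prob_space[simplified])
    finally show ?thesis unfolding sq integral_mult_right_zero by simp
  qed
  moreover have "Re (1 - char M u) \<le> norm (1 - char M u)" by (rule complex_Re_le_cmod)
  ultimately show ?thesis
    unfolding norm_minus_commute[of "char M (2 * u)" 1] norm_minus_commute[of "char M u" 1] by linarith
qed

text \<open>Repeated doubling extends the bound on [0, 1/L] to all u with quadratic growth. The
  exponential form is made to be absorbed by the Laplace factor exp (-u L), leaving exp (-u L /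
  2).\<close>

lemma (in real_distribution) norm_one_minus_char_le_exp:
  assumes L: "L > 0" and c: "\<And>u. \<lbrakk>0 \<le> u; u \<le> 1 / L\<rbrakk> \<Longrightarrow> norm (1 - char M u) \<le> c" and u: "u \<ge> 0"
  shows "norm (1 - char M u) \<le> 32 * c * exp (u * L / 2)"
proof -
  have c0: "c \<ge> 0" using c[of 0] L by (simp add: char_zero)
  \<comment> \<open>The inner factor 4 makes the induction close: after halving u the maximum is
    that of 1 and (u L)^2, which equals (u L)^2 once u L > 1.\<close>
  have *: "norm (1 - char M u) \<le> c * max 1 (4 * (u * L)\<^sup>2)" if "0 \<le> u" "u * L \<le> 2 ^ k" for k :: nat and u
    using that
  proof (induction k arbitrary: u)
    case 0
    then have "norm (1 - char M u) \<le> c * 1" using c[of u] L by (simp add: field_simps)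
    also have "\<dots> \<le> c * max 1 (4 * (u * L)\<^sup>2)" using c0 by (intro mult_left_mono) auto
    finally show ?case .
  next
    case (Suc k)
    show ?case
    proof (cases "u * L \<le> 1")
      case True
      then have "norm (1 - char M u) \<le> c * 1" using c[of u] L Suc.prems by (simp add: field_simps)
      also have "\<dots> \<le> c * max 1 (4 * (u * L)\<^sup>2)" using c0 by (intro mult_left_mono) auto
      finally show ?thesis .
    next
      case False
      then have 1: "(u * L)\<^sup>2 \<ge> 1" by (simp add: one_le_power)
      have "norm (1 - char M u) \<le> 4 * norm (1 - char M (u / 2))"
        using norm_one_minus_char_double[of "u / 2"] by simp
      also have "\<dots> \<le> 4 * (c * max 1 (4 * (u / 2 * L)\<^sup>2))"
        using Suc.prems by (intro mult_left_mono Suc.IH) auto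
      also have "\<dots> = c * (4 * max 1 ((u * L)\<^sup>2))" by (simp add: power2_eq_square)
      also have "\<dots> = c * max 1 (4 * (u * L)\<^sup>2)" using 1 by simp
      finally show ?thesis .
    qed
  qed
  obtain k :: nat where "u * L < 2 ^ k" using real_arch_pow[of 2 "u * L"] by auto
  then have "norm (1 - char M u) \<le> c * max 1 (4 * (u * L)\<^sup>2)" using *[of u k] u by simp
  moreover have "max 1 (4 * (u * L)\<^sup>2) \<le> 32 * exp (u * L / 2)"
  proof -
    have "1 + u * L / 2 + (u * L / 2)\<^sup>2 / 2 \<le> exp (u * L / 2)"
      using u L by (intro exp_lower_Taylor_quadratic) simp
    moreover have "(u * L / 2)\<^sup>2 / 2 = (u * L)\<^sup>2 / 8" by (simp add: power2_eq_square)
    moreover have "u * L \<ge> 0" "(u * L)\<^sup>2 \<ge> 0" using u L by auto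
    ultimately have "8 * exp (u * L / 2) \<ge> 8 + (u * L)\<^sup>2" by linarith
    then show ?thesis using zero_le_power2[of "u * L"] by (intro max.boundedI) linarith+
  qed
  then have "c * max 1 (4 * (u * L)\<^sup>2) \<le> c * (32 * exp (u * L / 2))" using c0 by (rule mult_left_mono)
  ultimately show ?thesis by (simp add: mult_ac)
qed

section \<open>Reciprocal Cauchy transforms\<close>

lemma laplace_kernel:
  assumes "Im w > 0"
  shows "set_integrable lborel {0<..} (\<lambda>s. exp (\<i> * of_real s * w))"
    and "(LINT s:{0<..}|lborel. exp (\<i> * of_real s * w)) = \<i> / w"
proof -
  have w: "w \<noteq> 0" using assms by auto
  have norm: "norm (exp (\<i> * of_real s * w)) = exp (- (s * Im w))" for s by simp
  show int: "set_integrable lborel {0<..} (\<lambda>s. exp (\<i> * of_real s * w))"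
    using integrable_I0i_exp_mscale[OF assms] unfolding set_integrable_def
    by (rule Bochner_Integration.integrable_bound) (auto simp: norm indicator_def)
  have "(LBINT s=0..\<infinity>. exp (\<i> * of_real s * w)) = 0 - (- \<i> / w)"
  proof (rule interval_integral_FTC_integrable[where F = "\<lambda>s. - \<i> / w * exp (\<i> * of_real s * w)"])
    show "((\<lambda>s. - \<i> / w * exp (\<i> * of_real s * w)) has_vector_derivative exp (\<i> * of_real s * w)) (at s)" for s
    proof -
      have "((\<lambda>\<zeta>. - \<i> / w * exp (\<i> * \<zeta> * w)) has_field_derivative exp (\<i> * of_real s * w)) (at (of_real s))"
        using w by (auto intro!: derivative_eq_intros)
      then show ?thesis by (rule has_vector_derivative_real_field)
    qed
    show "isCont (\<lambda>s. exp (\<i> * of_real s * w)) s" for s by (intro continuous_intros)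
    have e: "einterval 0 \<infinity> = {0<..}" by (auto simp: einterval_def zero_ereal_def)
    show "set_integrable lborel (einterval 0 \<infinity>) (\<lambda>s. exp (\<i> * of_real s * w))" unfolding e by (rule int)
    have "isCont (\<lambda>s. - \<i> / w * exp (\<i> * of_real s * w)) 0" by (intro continuous_intros)
    then have "((\<lambda>s. - \<i> / w * exp (\<i> * of_real s * w)) \<longlongrightarrow> - \<i> / w) (at_right (0::real))"
      by (simp add: isCont_def filterlim_at_split)
    then show "(((\<lambda>s. - \<i> / w * exp (\<i> * of_real s * w)) \<circ> real_of_ereal) \<longlongrightarrow> - \<i> / w) (at_right 0)"
      by (simp add: zero_ereal_def ereal_tendsto_simps)
    have "((\<lambda>s. norm (- \<i> / w * exp (\<i> * of_real s * w))) \<longlongrightarrow> 0) at_top"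
    proof -
      have "((\<lambda>s. 1 / norm w * exp (- (s * Im w))) \<longlongrightarrow> 0) at_top" using assms by real_asymp
      then show ?thesis by (simp add: norm_mult norm_divide)
    qed
    then have "((\<lambda>s. - \<i> / w * exp (\<i> * of_real s * w)) \<longlongrightarrow> 0) at_top" by (rule tendsto_norm_zero_cancel)
    then show "(((\<lambda>s. - \<i> / w * exp (\<i> * of_real s * w)) \<circ> real_of_ereal) \<longlongrightarrow> 0) (at_left \<infinity>)"
      by (simp add: ereal_tendsto_simps)
  qed simp
  then show "(LINT s:{0<..}|lborel. exp (\<i> * of_real s * w)) = \<i> / w"
    by (simp add: interval_lebesgue_integral_0_infty)
qed

text \<open>Integrating the Laplace representation of \<open>1 / (z - t)\<close> against the distribution turns its
  Cauchy transform into a Laplace transform of its characteristic function.\<close>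

lemma (in real_distribution) norm_cauchy_transform_diff_le:
  assumes L: "L > 0" and c: "\<And>u. \<lbrakk>0 \<le> u; u \<le> 1 / L\<rbrakk> \<Longrightarrow> norm (1 - char M u) \<le> c" and z: "Im z \<ge> L"
  shows "norm ((\<integral>t. 1 / (z - complex_of_real t) \<partial>M) - 1 / z) \<le> 64 * c / L"
proof -
  have z0: "Im z > 0" "z \<noteq> 0" using z L by auto
  have c0: "c \<ge> 0" using c[of 0] L by (simp add: char_zero)
  \<comment> \<open>The integrand of i / (z - t) - i / z. The subtraction is done before integrating
    in t, so that 1 - \<phi> appears.\<close>
  define k where "k t s = indicator {0<..} s *\<^sub>R (exp (\<i> * of_real s * z) * (iexp (- s * t) - 1))" for t s :: real
  interpret pair_sigma_finite M lborel ..
  have km [measurable]: "(\<lambda>(t, s). k t s) \<in> borel_measurable (M \<Otimes>\<^sub>M lborel)"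
    unfolding k_def by measurable
  define q where "q s = indicator {0<..} s *\<^sub>R exp (- (s * Im z))" for s :: real
  have q: "integrable lborel q"
    unfolding q_def using integrable_I0i_exp_mscale[OF z0(1)] by (simp add: set_integrable_def)
  have norm_k: "norm (k t s) \<le> 2 * q s" for t s
  proof -
    have "norm (iexp (- s * t) - 1) \<le> 2"
      by (rule order_trans[OF norm_triangle_ineq4]) (simp add: norm_exp_i_times del: of_real_mult of_real_minus)
    then show ?thesis unfolding k_def q_def
      by (simp add: norm_mult indicator_def mult.commute)
  qed
  have k_t: "integrable lborel (k t)" for t
  proof (rule Bochner_Integration.integrable_bound)
    show "integrable lborel (\<lambda>s. 2 * q s)" using q by simp
    show "AE s in lborel. norm (k t s) \<le> norm (2 * q s)"
      using norm_k[of t] by (intro AE_I2) (smt (verit) real_norm_def)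
  qed (unfold k_def, measurable)
  have int: "integrable (M \<Otimes>\<^sub>M lborel) (\<lambda>(t, s). k t s)"
  proof (rule Fubini_integrable[OF km])
    show "integrable M (\<lambda>t. \<integral>s. norm (case (t, s) of (t, s) \<Rightarrow> k t s) \<partial>lborel)"
    proof (rule integrable_const_bound)
      show "AE t in M. norm (\<integral>s. norm (case (t, s) of (t, s) \<Rightarrow> k t s) \<partial>lborel) \<le> (\<integral>s. 2 * q s \<partial>lborel)"
      proof (rule AE_I2)
        fix t
        have "(\<integral>s. norm (k t s) \<partial>lborel) \<le> (\<integral>s. 2 * q s \<partial>lborel)"
          using k_t[of t] q norm_k by (intro integral_mono) auto
        then show "norm (\<integral>s. norm (case (t, s) of (t, s) \<Rightarrow> k t s) \<partial>lborel) \<le> (\<integral>s. 2 * q s \<partial>lborel)" by simp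
      qed
    qed measurable
    show "AE t in M. integrable lborel (\<lambda>s. case (t, s) of (t, s) \<Rightarrow> k t s)" using k_t by simp
  qed
  have lap: "(\<integral>s. k t s \<partial>lborel) = \<i> / (z - of_real t) - \<i> / z" for t
  proof -
    have zt: "Im (z - of_real t) > 0" using z0 by simp
    note l1 = laplace_kernel[OF zt, unfolded set_integrable_def set_lebesgue_integral_def]
    note l2 = laplace_kernel[OF z0(1), unfolded set_integrable_def set_lebesgue_integral_def]
    have "k t s = indicator {0<..} s *\<^sub>R exp (\<i> * of_real s * (z - of_real t)) - indicator {0<..} s *\<^sub>R exp (\<i> * of_real s * z)" for s
    proof -
      have "exp (\<i> * of_real s * (z - of_real t)) = exp (\<i> * of_real s * z) * iexp (- s * t)"
        unfolding exp_add[symmetric] by (simp add: algebra_simps)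
      then show ?thesis unfolding k_def by (simp only: scaleR_diff_right right_diff_distrib mult_1_right)
    qed
    then show ?thesis using l1 l2 by simp
  qed
  have swap: "(\<integral>t. \<integral>s. k t s \<partial>lborel \<partial>M) = (\<integral>s. \<integral>t. k t s \<partial>M \<partial>lborel)"
    using Fubini_integral[OF int] by simp
  have k_s: "(\<integral>t. k t s \<partial>M) = indicator {0<..} s *\<^sub>R (exp (\<i> * of_real s * z) * (char M (- s) - 1))" for s
  proof -
    have "integrable M (\<lambda>t. iexp (- s * t))" by (rule integrable_iexp) auto
    then show ?thesis unfolding k_def char_def by (simp add: prob_space[simplified])
  qed
  have iG: "integrable M (\<lambda>t. 1 / (z - complex_of_real t))"
    by (rule integrable_cauchy_kernel) (use z0 in \<open>auto intro: finite_measure_axioms\<close>)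
  have "(\<integral>t. \<i> * (1 / (z - complex_of_real t)) - \<i> / z \<partial>M) = \<i> * (\<integral>t. 1 / (z - complex_of_real t) \<partial>M) - \<i> / z"
    unfolding Bochner_Integration.integral_diff[OF integrable_mult_right[OF iG] integrable_const] integral_mult_right_zero
    by (simp add: prob_space[simplified])
  then have "\<i> * ((\<integral>t. 1 / (z - complex_of_real t) \<partial>M) - 1 / z) = (\<integral>s. \<integral>t. k t s \<partial>M \<partial>lborel)"
    unfolding swap[symmetric] lap by (simp add: right_diff_distrib)
  then have "norm ((\<integral>t. 1 / (z - complex_of_real t) \<partial>M) - 1 / z) = norm (\<integral>s. \<integral>t. k t s \<partial>M \<partial>lborel)"
    by (metis norm_mult norm_ii mult_1)
  also have "\<dots> \<le> (\<integral>s. norm (\<integral>t. k t s \<partial>M) \<partial>lborel)" by (rule integral_norm_bound)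
  also have "\<dots> \<le> (\<integral>s. 32 * c * (indicator {0<..} s *\<^sub>R exp (- (s * (L / 2)))) \<partial>lborel)"
  proof (rule integral_mono)
    show "integrable lborel (\<lambda>s. norm (\<integral>t. k t s \<partial>M))"
      using integrable_snd[OF int] by auto
    show "integrable lborel (\<lambda>s. 32 * c * (indicator {0<..} s *\<^sub>R exp (- (s * (L / 2)))))"
      using integrable_I0i_exp_mscale[of "L / 2"] L by (intro integrable_mult_right) (simp add: set_integrable_def)
    fix s :: real
    show "norm (\<integral>t. k t s \<partial>M) \<le> 32 * c * (indicator {0<..} s *\<^sub>R exp (- (s * (L / 2))))"
    proof (cases "s > 0")
      case True
      have "norm (char M (- s) - 1) = norm (1 - char M s)"
        unfolding char_minus by (metis complex_cnj_diff complex_cnj_one complex_mod_cnj norm_minus_commute)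
      also have "\<dots> \<le> 32 * c * exp (s * L / 2)" by (rule norm_one_minus_char_le_exp[OF L c]) (use True in auto)
      finally have "exp (- (s * Im z)) * norm (char M (- s) - 1) \<le> exp (- (s * L)) * (32 * c * exp (s * L / 2))"
        using True z by (intro mult_mono) auto
      also have "\<dots> = 32 * c * exp (- (s * (L / 2)))"
        by (simp add: mult_ac flip: exp_add)
      finally show ?thesis using True unfolding k_s by (simp add: norm_mult)
    qed (simp add: k_s)
  qed
  also have "\<dots> = 32 * c * (LBINT s=0..\<infinity>. exp (- (s * (L / 2))))"
    by (simp add: interval_lebesgue_integral_0_infty set_lebesgue_integral_def)
  also have "\<dots> = 64 * c / L" using L by (subst LBINT_I0i_exp_mscale) auto
  finally show ?thesis .
qed

section \<open>Mapping properties and displacement of the reciprocal Cauchy transform\<close>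

context real_distribution
begin

text \<open>For X = 1 / (z - t) one has |X|^2 = -Im X / Im z, so the decomposition of the second
  moment of X into squared mean and variance becomes a formula for the imaginary part of the mean
  G.\<close>

lemma cauchy_transform_identities:
  assumes z: "Im z > 0"
  defines "G \<equiv> (\<integral>t. 1 / (z - complex_of_real t) \<partial>M)"
  shows "- Im G = Im z * ((norm G)\<^sup>2 + (\<integral>t. (norm (1 / (z - complex_of_real t) - G))\<^sup>2 \<partial>M))"
    and "integrable M (\<lambda>t. (norm (1 / (z - complex_of_real t) - G))\<^sup>2)"
proof -
  define X where "X t = 1 / (z - complex_of_real t)" for t
  have [measurable]: "X \<in> borel_measurable borel" unfolding X_def by measurable
  have iX: "integrable M X" unfolding X_def
    by (rule integrable_cauchy_kernel) (use z in \<open>auto intro: finite_measure_axioms\<close>)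
  have sq: "(norm (X t))\<^sup>2 = - Im (X t) / Im z" for t
  proof -
    have "Im (X t) = - Im z / (norm (z - of_real t))\<^sup>2"
      unfolding X_def by (simp add: Im_divide cmod_power2)
    then show ?thesis using z by (simp add: X_def norm_divide power_divide)
  qed
  have iIm: "integrable M (\<lambda>t. Im (X t))" using iX by auto
  have eq: "(norm (X t - G))\<^sup>2 = - Im (X t) / Im z - 2 * Re (X t * cnj G) + (norm G)\<^sup>2" for t
    unfolding sq[symmetric] cmod_power2 by (simp add: power2_eq_square algebra_simps)
  have iRe: "integrable M (\<lambda>t. Re (X t * cnj G))" using iX by (intro integrable_Re integrable_mult_left)
  have i: "integrable M (\<lambda>t. (norm (X t - G))\<^sup>2)"
    unfolding eq by (intro Bochner_Integration.integrable_add Bochner_Integration.integrable_diff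
        integrable_mult_right iRe integrable_const) (use iIm in simp)
  then show "integrable M (\<lambda>t. (norm (1 / (z - complex_of_real t) - G))\<^sup>2)" by (simp add: X_def)
  have "(\<integral>t. (norm (X t - G))\<^sup>2 \<partial>M) = - Im G / Im z - 2 * Re (G * cnj G) + (norm G)\<^sup>2"
  proof -
    have G: "G = (\<integral>t. X t \<partial>M)" by (simp add: G_def X_def)
    have "(\<integral>t. Im (X t) \<partial>M) = Im G" using integral_Im[OF iX] by (simp add: G)
    moreover have "(\<integral>t. Re (X t * cnj G) \<partial>M) = Re (G * cnj G)"
      unfolding integral_Re[OF integrable_mult_left[OF iX, of "cnj G"]] integral_mult_left_zero by (simp add: G)
    moreover have "integrable M (\<lambda>t. - Im (X t) / Im z)" using iIm by simp
    moreover note integrable_mult_right[OF iRe, of 2]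
    ultimately show ?thesis
      unfolding eq by (simp add: prob_space[simplified] del: times_complex.sel complex_cnj)
  qed
  also have "Re (G * cnj G) = (norm G)\<^sup>2" unfolding cmod_power2 by (simp add: power2_eq_square)
  finally show "- Im G = Im z * ((norm G)\<^sup>2 + (\<integral>t. (norm (1 / (z - complex_of_real t) - G))\<^sup>2 \<partial>M))"
    using z by (simp add: X_def field_simps)
qed

lemma Im_cauchy_transform_neg:
  assumes z: "Im z > 0"
  shows "Im (\<integral>t. 1 / (z - complex_of_real t) \<partial>M) < 0"
proof -
  define G where "G = (\<integral>t. 1 / (z - complex_of_real t) \<partial>M)"
  note id = cauchy_transform_identities[OF z, folded G_def]
  have V: "(\<integral>t. (norm (1 / (z - complex_of_real t) - G))\<^sup>2 \<partial>M) \<ge> 0" by simp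
  have "G \<noteq> 0"
  proof
    assume "G = 0"
    then have "(\<integral>t. (norm (1 / (z - complex_of_real t) - G))\<^sup>2 \<partial>M) = 0" using id(1) z by simp
    then have "AE t in M. (norm (1 / (z - complex_of_real t) - G))\<^sup>2 = 0"
      using integral_nonneg_eq_0_iff_AE[OF id(2)] by simp
    then have "AE t in M. (norm (1 / (z - complex_of_real t)))\<^sup>2 = 0"
      unfolding \<open>G = 0\<close> by simp
    moreover have "(norm (1 / (z - complex_of_real t)))\<^sup>2 \<noteq> 0" for t
    proof -
      have "z - complex_of_real t \<noteq> 0" using z by (auto simp: complex_eq_iff)
      then show ?thesis by simp
    qed
    ultimately have "AE t in M. False" by simp
    then show False by (simp add: AE_False)
  qed
  then have "Im z * ((norm G)\<^sup>2 + (\<integral>t. (norm (1 / (z - complex_of_real t) - G))\<^sup>2 \<partial>M)) > 0"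
    using z V by (intro mult_pos_pos add_pos_nonneg) auto
  then show ?thesis using id(1) unfolding G_def by linarith
qed

lemma cauchy_transform_nz: "Im z > 0 \<Longrightarrow> (\<integral>t. 1 / (z - complex_of_real t) \<partial>M) \<noteq> 0"
  using Im_cauchy_transform_neg by force

text \<open>Dividing the variance identity by |G|^2 gives Im F = Im z (1 + V / |G|^2). The variance
  V vanishes only if 1 / (z - t), hence t, is almost surely constant.\<close>

lemma Im_F_transform:
  assumes z: "Im z > 0"
  shows "Im (F_transform M z) \<ge> Im z"
    and "(\<And>a. \<not> (AE t in M. t = a)) \<Longrightarrow> Im (F_transform M z) > Im z"
proof -
  define G where "G = (\<integral>t. 1 / (z - complex_of_real t) \<partial>M)"
  define V where "V = (\<integral>t. (norm (1 / (z - complex_of_real t) - G))\<^sup>2 \<partial>M)"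
  note id = cauchy_transform_identities[OF z, folded G_def, folded V_def]
  have G: "G \<noteq> 0" unfolding G_def by (rule cauchy_transform_nz[OF z])
  have V0: "V \<ge> 0" by (simp add: V_def)
  have "Im (F_transform M z) = - Im G / (norm G)\<^sup>2"
    unfolding F_transform_def G_def[symmetric] by (simp add: cmod_power2)
  also have "\<dots> = Im z * (1 + V / (norm G)\<^sup>2)"
    unfolding id(1) using G by (simp add: field_simps)
  finally have eq: "Im (F_transform M z) = Im z * (1 + V / (norm G)\<^sup>2)" .
  have "Im z * 1 \<le> Im z * (1 + V / (norm G)\<^sup>2)" using z V0 by (intro mult_left_mono) auto
  then show "Im (F_transform M z) \<ge> Im z" unfolding eq by simp
  assume nd: "\<And>a. \<not> (AE t in M. t = a)"
  have "V \<noteq> 0"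
  proof
    assume "V = 0"
    then have "AE t in M. (norm (1 / (z - complex_of_real t) - G))\<^sup>2 = 0"
      unfolding V_def using integral_nonneg_eq_0_iff_AE[OF id(2)] by simp
    then have "AE t in M. t = Re (z - 1 / G)"
    proof eventually_elim
      case (elim t)
      then have "1 / (z - complex_of_real t) = G" by simp
      then have "z - complex_of_real t = 1 / G" by (metis divide_divide_eq_right div_by_1 mult_1)
      then have "complex_of_real t = z - 1 / G" by (simp add: algebra_simps)
      then show ?case by (metis Re_complex_of_real)
    qed
    then show False using nd by blast
  qed
  then have "Im z * 1 < Im z * (1 + V / (norm G)\<^sup>2)" using z V0 G by (intro mult_strict_left_mono) auto
  then show "Im (F_transform M z) > Im z" unfolding eq by simp
qed

lemma F_transform_holomorphic: "F_transform M holomorphic_on \<H>"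
proof -
  have "(\<lambda>z. inverse (\<integral>t. 1 / (z - complex_of_real t) \<partial>M)) holomorphic_on \<H>"
    using cauchy_transform_nz
    by (intro holomorphic_intros cauchy_transform_holomorphic) (auto intro: finite_measure_axioms)
  then show ?thesis unfolding F_transform_def[abs_def] .
qed

lemma F_transform_imaginary_axis:
  "(\<lambda>n. F_transform M (\<i> * of_nat n) / of_nat n) \<longlonglongrightarrow> \<i>"
proof -
  have "(\<lambda>n. \<integral>t. of_nat n / (\<i> * of_nat n - complex_of_real t) \<partial>M) \<longlonglongrightarrow> (\<integral>t. 1 / \<i> \<partial>M)"
  proof (rule integral_dominated_convergence[where w = "\<lambda>_. 1"])
    show "AE t in M. (\<lambda>n. of_nat n / (\<i> * of_nat n - complex_of_real t)) \<longlonglongrightarrow> 1 / \<i>"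
    proof (rule AE_I2)
      fix t :: real
      have "(\<lambda>n. complex_of_real (t / real n)) \<longlonglongrightarrow> complex_of_real 0"
        by (intro tendsto_of_real) real_asymp
      then have "(\<lambda>n. 1 / (\<i> - complex_of_real (t / real n))) \<longlonglongrightarrow> 1 / (\<i> - complex_of_real 0)"
        by (intro tendsto_intros) auto
      then have "(\<lambda>n. 1 / (\<i> - complex_of_real (t / real n))) \<longlonglongrightarrow> 1 / \<i>"
        by (simp only: of_real_0 diff_zero)
      then show "(\<lambda>n. of_nat n / (\<i> * of_nat n - complex_of_real t)) \<longlonglongrightarrow> 1 / \<i>"
      proof (rule Lim_transform_eventually)
        show "eventually (\<lambda>n. 1 / (\<i> - complex_of_real (t / real n)) = of_nat n / (\<i> * of_nat n - complex_of_real t)) sequentially"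
          using eventually_gt_at_top[of 0] by eventually_elim (simp add: field_simps)
      qed
    qed
    show "AE t in M. norm (of_nat n / (\<i> * of_nat n - complex_of_real t)) \<le> 1" for n
    proof (rule AE_I2)
      fix t
      have "real n \<le> norm (\<i> * of_nat n - complex_of_real t)"
        using abs_Im_le_cmod[of "\<i> * of_nat n - complex_of_real t"] by simp
      then show "norm (of_nat n / (\<i> * of_nat n - complex_of_real t)) \<le> 1"
        by (auto simp: norm_divide divide_le_eq_1)
    qed
  qed auto
  then have "(\<lambda>n. \<integral>t. of_nat n / (\<i> * of_nat n - complex_of_real t) \<partial>M) \<longlonglongrightarrow> 1 / \<i>"
    by (simp add: prob_space[simplified])
  then have "(\<lambda>n. inverse (\<integral>t. of_nat n / (\<i> * of_nat n - complex_of_real t) \<partial>M)) \<longlonglongrightarrow> inverse (1 / \<i>)"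
    by (rule tendsto_inverse) simp
  moreover have "inverse (\<integral>t. of_nat n / (\<i> * of_nat n - complex_of_real t) \<partial>M) = F_transform M (\<i> * of_nat n) / of_nat n" for n
    using integral_mult_right_zero[of M "of_nat n" "\<lambda>t. 1 / (\<i> * of_nat n - complex_of_real t)"]
    unfolding F_transform_def by (simp add: field_simps)
  ultimately show ?thesis by simp
qed

lemma F_transform_boundary_map:
  assumes "boundary_restriction M T"
  shows "boundary_map (F_transform M) T"
proof
  show "F_transform M holomorphic_on \<H>" by (rule F_transform_holomorphic)
  show "F_transform M z \<in> \<H>" if "z \<in> \<H>" for z using Im_F_transform(1)[of z] that by simp
qed (use assms in \<open>auto simp: boundary_restriction_def\<close>)

text \<open>Since F - z = z (1 - z G) / (z G), it suffices that |z G - 1| \<le> 2 L (64 c / L) = 128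
  c, which is at most 1/2 because c \<le> 1/256. The constant is 2 times 128 times 2.\<close>

lemma norm_F_transform_diff_le:
  assumes L: "L > 0" and c: "\<And>u. \<lbrakk>0 \<le> u; u \<le> 1 / L\<rbrakk> \<Longrightarrow> norm (1 - char M u) \<le> c"
    and c_small: "c \<le> 1 / 256" and z: "Im z \<ge> L" "norm z \<le> 2 * L"
  shows "norm (F_transform M z - z) \<le> 512 * c * L"
proof -
  define G where "G = (\<integral>t. 1 / (z - complex_of_real t) \<partial>M)"
  have z0: "z \<noteq> 0" "Im z > 0" using z L by auto
  have c0: "c \<ge> 0" using c[of 0] L by (simp add: char_zero)
  have "norm (z * G - 1) = norm z * norm (G - 1 / z)"
    unfolding norm_mult[symmetric] using z0 by (simp add: right_diff_distrib)
  also have "\<dots> \<le> (2 * L) * (64 * c / L)"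
    unfolding G_def using z(2) L by (intro mult_mono norm_cauchy_transform_diff_le[OF L c z(1)]) auto
  also have "\<dots> = 128 * c" using L by simp
  finally have 1: "norm (z * G - 1) \<le> 128 * c" .
  then have 2: "norm (z * G) \<ge> 1 / 2"
    using norm_triangle_ineq2[of 1 "1 - z * G"] c_small by (simp add: norm_minus_commute)
  have G: "G \<noteq> 0" unfolding G_def by (rule cauchy_transform_nz[OF z0(2)])
  have "F_transform M z - z = z * (1 - z * G) / (z * G)"
    unfolding F_transform_def G_def[symmetric] using G z0 by (simp add: field_simps)
  then have "norm (F_transform M z - z) = norm z * norm (z * G - 1) / norm (z * G)"
    by (simp add: norm_mult norm_divide norm_minus_commute)
  also have "\<dots> \<le> (2 * L) * (128 * c) / (1 / 2)"
    using 1 2 z c0 L by (intro frac_le mult_mono) auto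
  finally show ?thesis by (simp add: mult_ac)
qed

text \<open>The value 1/512 cancels the constant of the step estimate, so each step has length at
  most L / n and n steps stay in the disc of radius L about i L. The lower bound on heights persists
  because \<open>F\<close> never decreases them; both are needed to apply the step estimate
  again.\<close>

lemma norm_funpow_F_transform_le:
  assumes L: "L > 0" and n: "n \<ge> 1" and c: "\<And>u. \<lbrakk>0 \<le> u; u \<le> 1 / L\<rbrakk> \<Longrightarrow> real n * norm (1 - char M u) \<le> 1 / 512"
  shows "norm ((F_transform M ^^ n) (\<i> * of_real L)) \<le> 2 * L \<and> Im ((F_transform M ^^ n) (\<i> * of_real L)) \<ge> L"
proof -
  define z where "z k = (F_transform M ^^ k) (\<i> * of_real L)" for k
  have c': "norm (1 - char M u) \<le> 1 / (512 * real n)" if "0 \<le> u" "u \<le> 1 / L" for u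
    using c[OF that] n by (simp add: field_simps)
  have near: "norm w \<le> 2 * L" if "norm (w - \<i> * of_real L) \<le> L" for w
    using norm_triangle_ineq2[of w "\<i> * of_real L"] that L by (simp add: norm_mult)
  have "norm (z k - \<i> * of_real L) \<le> real k * L / real n \<and> Im (z k) \<ge> L" if "k \<le> n" for k
    using that
  proof (induction k)
    case 0
    then show ?case by (simp add: z_def)
  next
    case (Suc k)
    then have IH: "norm (z k - \<i> * of_real L) \<le> real k * L / real n" "Im (z k) \<ge> L" by auto
    have "real k * L / real n \<le> L" using Suc.prems n L by (simp add: field_simps)
    then have "norm (z k) \<le> 2 * L" using IH near by simp
    then have "norm (F_transform M (z k) - z k) \<le> 512 * (1 / (512 * real n)) * L"
      using IH n by (intro norm_F_transform_diff_le[OF L c']) (auto simp: field_simps)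
    then have "norm (z (Suc k) - z k) \<le> L / real n" by (simp add: z_def)
    then have "norm (z (Suc k) - \<i> * of_real L) \<le> real k * L / real n + L / real n"
      using IH(1) norm_triangle_ineq[of "z (Suc k) - z k" "z k - \<i> * of_real L"] by simp
    also have "\<dots> = real (Suc k) * L / real n" by (simp add: add_divide_distrib algebra_simps)
    finally show ?case using Im_F_transform(1)[of "z k"] IH(2) L by (simp add: z_def)
  qed
  from this[of n] show ?thesis using near[of "z n"] n L by (simp add: z_def)
qed

end

section \<open>Divergence of the orbit series\<close>

lemma orbit_not_summable:
  assumes \<mu>: "real_distribution \<mu>" and clt: "clt_norming \<mu> B"
    and div: "filterlim (\<lambda>N. \<Sum>n = 1..N. 1 / (B n)\<^sup>2) at_top sequentially"
  shows "\<not> summable (\<lambda>n. Im ((F_transform \<mu> ^^ n) \<i>) / (norm ((F_transform \<mu> ^^ n) \<i>))\<^sup>2)"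
proof
  interpret real_distribution \<mu> by fact
  let ?F = "F_transform \<mu>"
  assume sum: "summable (\<lambda>n. Im ((?F ^^ n) \<i>) / (norm ((?F ^^ n) \<i>))\<^sup>2)"
  obtain \<delta> n0 where \<delta>: "\<delta> > 0" and n0: "n0 \<ge> 1"
    and small: "\<And>n s. \<lbrakk>n \<ge> n0; 0 \<le> s; s \<le> \<delta>\<rbrakk> \<Longrightarrow> real n * norm (char \<mu> (s / B n) - 1) \<le> 1 / 512"
    using clt_norming_char_small[OF \<mu> clt, of "1 / 512"] by auto
  have B: "B n > 0" if "n \<ge> 1" for n using clt that by (simp add: clt_norming_def)
  \<comment> \<open>The comparison of i with i L is made for L \<ge> 1.\<close>
  define L where "L n = max 1 (B n / \<delta>)" for n
  have L: "L n \<ge> 1" for n by (simp add: L_def)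
  have F_map: "(?F ^^ n) z \<in> \<H>" if "z \<in> \<H>" for n z
    by (induction n) (use that Im_F_transform(1) in \<open>auto intro: less_le_trans\<close>)
  have F_hol: "(?F ^^ n) holomorphic_on \<H>" for n
  proof (induction n)
    case (Suc n)
    then show ?case
      unfolding funpow.simps(2) by (rule holomorphic_on_compose_gen[OF _ F_transform_holomorphic]) (use F_map in auto)
  qed (simp add: holomorphic_on_id)
  have Im_inv: "Im (- 1 / w) = Im w / (norm w)\<^sup>2" for w by (simp add: Im_divide cmod_power2)
  have low: "1 / (4 * (L n)\<^sup>2) \<le> Im ((?F ^^ n) \<i>) / (norm ((?F ^^ n) \<i>))\<^sup>2" if n: "n \<ge> n0" for n
  proof -
    let ?w = "(?F ^^ n) (\<i> * of_real (L n))"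
    have n1: "n \<ge> 1" using n n0 by simp
    have "norm ?w \<le> 2 * L n \<and> Im ?w \<ge> L n"
    proof (rule norm_funpow_F_transform_le[OF _ n1])
      show "L n > 0" using L[of n] by simp
      fix u assume u: "0 \<le> u" "u \<le> 1 / L n"
      have "u * B n \<le> 1 / L n * B n" using u B[OF n1] by (intro mult_right_mono) auto
      also have "\<dots> \<le> \<delta>"
      proof -
        have "B n / \<delta> \<le> L n" by (simp add: L_def)
        then show ?thesis using \<delta> L[of n] by (simp add: field_simps)
      qed
      finally show "real n * norm (1 - char \<mu> u) \<le> 1 / 512"
        using small[of n "u * B n"] n u B[OF n1] by (simp add: norm_minus_commute)
    qed
    then have w: "norm ?w \<le> 2 * L n" "Im ?w \<ge> L n" by auto
    have w0: "norm ?w > 0" using w L[of n] by auto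
    \<comment> \<open>The bounds on \<open>?w\<close> give Im w / |w|^2 \<ge> 1 / (4 L); a further
      factor 1 / L is lost in passing from i L to i.\<close>
    have "1 / (4 * (L n)\<^sup>2) = (L n / (2 * L n)\<^sup>2) / L n" using L[of n] by (simp add: power2_eq_square)
    also have "\<dots> \<le> (Im ?w / (norm ?w)\<^sup>2) / L n"
      using w w0 L[of n] by (intro divide_right_mono frac_le power_mono) auto
    also have "\<dots> = Im (- 1 / ?w) / L n" by (simp only: Im_inv)
    also have "\<dots> \<le> Im (- 1 / (?F ^^ n) \<i>)"
    proof (rule schwarz_pick_uhp_axis[OF _ _ L])
      show "(\<lambda>z. - 1 / (?F ^^ n) z) holomorphic_on \<H>"
      proof (intro holomorphic_intros F_hol)
        show "(?F ^^ n) z \<noteq> 0" if "z \<in> \<H>" for z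
          using F_map[OF that, of n] by (auto simp: complex_eq_iff)
      qed
      show "- 1 / (?F ^^ n) z \<in> \<H>" if "z \<in> \<H>" for z
        using F_map[OF that, of n] unfolding mem_Collect_eq Im_inv by (intro divide_pos_pos) auto
    qed
    finally show ?thesis unfolding Im_inv .
  qed
  have "summable (\<lambda>n. 1 / (4 * (L n)\<^sup>2))"
    by (rule summable_comparison_test'[OF sum, of n0]) (use low in simp)
  then have "summable (\<lambda>n. 4 * (1 / (4 * (L n)\<^sup>2)))" by (rule summable_mult)
  then have sumL: "summable (\<lambda>n. 1 / (L n)\<^sup>2)" by simp
  \<comment> \<open>The assumed summability itself forces \<open>L n\<close> > 1 eventually, so the
    maximum is then \<open>B n / \<delta>\<close>.\<close>
  have "eventually (\<lambda>n. 1 / (L n)\<^sup>2 < 1) sequentially"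
    using summable_LIMSEQ_zero[OF sumL] by (intro order_tendstoD) auto
  then have ev: "eventually (\<lambda>n. 1 / (L n)\<^sup>2 = \<delta>\<^sup>2 / (B n)\<^sup>2) sequentially"
    by eventually_elim (auto simp: L_def max_def power_divide)
  have "summable (\<lambda>n. \<delta>\<^sup>2 / (B n)\<^sup>2)" using sumL summable_cong[OF ev] by simp
  then have "summable (\<lambda>n. 1 / \<delta>\<^sup>2 * (\<delta>\<^sup>2 / (B n)\<^sup>2))" by (rule summable_mult)
  then have sB: "summable (\<lambda>n. 1 / (B n)\<^sup>2)" using \<delta> by simp
  have "(\<Sum>n = 1..N. 1 / (B n)\<^sup>2) \<le> (\<Sum>n. 1 / (B n)\<^sup>2)" for N
    by (rule sum_le_suminf[OF sB]) auto
  moreover have "eventually (\<lambda>N. (\<Sum>n = 1..N. 1 / (B n)\<^sup>2) > (\<Sum>n. 1 / (B n)\<^sup>2)) sequentially"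
    using div by (simp add: filterlim_at_top_dense)
  ultimately show False by (auto simp: eventually_sequentially not_less[symmetric])
qed

theorem theorem3p9:
  fixes \<mu> :: "real measure" and B :: "nat \<Rightarrow> real" and T :: "real \<Rightarrow> real"
  assumes "real_distribution \<mu>"
    and "singular_to_lborel \<mu>"
    and "\<mu> \<in> strict_normal_domain"
    and "clt_norming \<mu> B"
    and "filterlim (\<lambda>N. \<Sum>n = 1..N. 1 / (B n)\<^sup>2) at_top sequentially"
    and "boundary_restriction \<mu> T"
  shows "measure_preserving_map lborel T \<and> conservative lborel T \<and> ergodic lborel T"
proof -
  interpret real_distribution \<mu> by fact
  interpret boundary_map "F_transform \<mu>" T
    by (rule F_transform_boundary_map) fact
  have Im_F: "Im (F_transform \<mu> z) \<ge> Im z" and Im_F_strict: "Im (F_transform \<mu> z) > Im z" if "z \<in> \<H>" for z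
    using that Im_F_transform clt_norming_not_dirac[OF assms(1,4)] by auto
  note div = orbit_not_summable[OF assms(1,4,5)]
  show ?thesis
    using measure_preserving[OF Im_F F_transform_imaginary_axis]
      conservative_if_orbit_not_summable[OF Im_F div] ergodic_if_orbit_not_summable[OF Im_F_strict div]
    by blast
qed

end
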